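(* The family of generalised Sierpinski triangles consists of exactly four types: $\triangle NNN$, $\triangle FNN$, $\triangle FFN$ and $\triangle FFF$. That is, if $K\subset\mathbb{R}^2$ is a generalised Sierpinski triangle with iterated function system $(\mathbb{R}^2; f_A,f_B,f_C)$, then each of the three maps $f_A,f_B,f_C$ is either a non-flip (N) map or a flip (F) map, so that, according to the number $0,1,2,3$ of flip maps, it is of type $\triangle NNN$, $\triangle FNN$, $\triangle FFN$ or $\triangle FFF$ respectively; and each of these four types occurs.
   Context: A similitude of $\mathbb{R}^2$ with scaling factor $s>0$ is a map $f(x)=s\,O x+b$ with $O$ a $2\times 2$ orthogonal matrix and $b\in\mathbb{R}^2$; it is contractive if $0<s<1$. The attractor of an iterated function system (IFS) $(\mathbb{R}^2;f_1,\dots,f_n)$ of contractive maps is the unique non-empty compact set $K\subset\mathbb{R}^2$ with $K=f_1(K)\cup\dots\cup f_n(K)$. Generalised Sierpinski triangle: the attractor $K$ of an IFS $(\mathbb{R}^2;f_A,f_B,f_C)$ such that (1) the IFS consists of exactly three contractive similitudes $f_A,f_B,f_C$; (2) the fixed points $A,B,C$ of $f_A,f_B,f_C$ respectively are the vertices of a (non-degenerate) triangle; (3) the attractor is non-overlapping and just touching: the three pieces $f_A(K),f_B(K),f_C(K)$ meet only at three points, namely $f_A(K)\cap f_B(K)=\{N\}$, $f_A(K)\cap f_C(K)=\{M\}$, $f_B(K)\cap f_C(K)=\{O\}$, where $f_A(\{B,C\})=\{N,M\}$, $f_B(\{A,C\})=\{N,O\}$, $f_C(\{A,B\})=\{M,O\}$;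 and each of these points is collinear with two different vertices: $N$ lies on the line $AB$, $M$ on the line $AC$, and $O$ on the line $BC$. Types of maps, described for the vertex $A$ (and similarly for $B$ and $C$): $f_A$ is a non-flip (N) map if it only scales and translates, i.e. $f_A(x)=A+s(x-A)$ for some $0<s<1$. It is a flip (F) map if it is a contractive similitude fixing $A$, involving a reflection, which exchanges the directions of the two sides adjacent to $A$, i.e. $f_A(x)=A+s\,R(x-A)$ for some $0<s<1$, where $R$ is the linear reflection that interchanges the directions of the rays $AB$ and $AC$. The type name lists the map types up to relabelling of the vertices: $\triangle NNN$ has no flip maps, $\triangle FNN$ one, $\triangle FFN$ two, and $\triangle FFF$ three. *)

theory Defs
  imports "HOL-Analysis.Analysis" "HOL-Library.Multiset"
begin

definition contractive_similitude :: "(real^2 \<Rightarrow> real^2) \<Rightarrow> bool" where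
  "contractive_similitude f \<longleftrightarrow>
     (\<exists>s Q b. 0 < s \<and> s < 1 \<and> orthogonal_matrix Q \<and> (\<forall>x. f x = s *\<^sub>R (Q *v x) + b))"

definition is_attractor :: "(real^2 \<Rightarrow> real^2) set \<Rightarrow> (real^2) set \<Rightarrow> bool" where
  "is_attractor F K \<longleftrightarrow> K \<noteq> {} \<and> compact K \<and> K = (\<Union>f\<in>F. f ` K)"

lemma contractive_similitude_dist:
  assumes "contractive_similitude f"
  obtains s where "0 < s" "s < 1" "\<And>x y. dist (f x) (f y) = s * dist x y"
proof -
  obtain s Q b where s: "0 < s" "s < 1" and Q: "orthogonal_matrix Q"
    and f: "\<And>x. f x = s *\<^sub>R (Q *v x) + b"
    using assms unfolding contractive_similitude_def by blast
  have "orthogonal_transformation ((*v) Q)"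
    using Q by (simp add: orthogonal_transformation_matrix)
  then have "norm (Q *v z) = norm z" for z
    by (rule orthogonal_transformation_norm)
  then have "dist (f x) (f y) = s * dist x y" for x y
    using s by (simp add: f dist_norm flip: scaleR_diff_right matrix_vector_mult_diff_distrib)
  with s show ?thesis by (rule that)
qed

lemma is_attractor_subset:
  assumes F: "\<And>f. f \<in> F \<Longrightarrow> contractive_similitude f"
    and K: "is_attractor F K" and L: "is_attractor F L"
  shows "K \<subseteq> L"
proof -
  have K': "K \<noteq> {}" "compact K" "K = (\<Union>f\<in>F. f ` K)"
    and L': "L \<noteq> {}" "closed L" "L = (\<Union>f\<in>F. f ` L)"
    using K L compact_imp_closed unfolding is_attractor_def by blast+
  have "continuous_on K (\<lambda>x. infdist x L)"
    by (intro continuous_intros)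
  then obtain x where x: "x \<in> K" "\<And>y. y \<in> K \<Longrightarrow> infdist y L \<le> infdist x L"
    using continuous_attains_sup[OF K'(2,1)] by blast
  obtain f y where f: "f \<in> F" "y \<in> K" "x = f y"
    using x(1) K'(3) by blast
  obtain s where s: "0 < s" "s < 1" "\<And>u v. dist (f u) (f v) = s * dist u v"
    using contractive_similitude_dist[OF F[OF f(1)]] by metis
  obtain z where z: "z \<in> L" "infdist y L = dist y z"
    using infdist_attains_inf[OF L'(2,1)] by metis
  have "f z \<in> L"
    using f(1) z(1) L'(3) by blast
  then have "infdist x L \<le> s * infdist y L"
    using infdist_le[of "f z" L x] by (simp add: f(3) s(3) z(2))
  also have "\<dots> \<le> s * infdist x L"
    using x(2)[OF f(2)] s(1) by simp
  finally have "(1 - s) * infdist x L \<le> 0"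
    by (simp add: algebra_simps)
  then have "infdist x L \<le> 0"
    using s(2) by (simp add: mult_le_0_iff)
  then have "infdist u L = 0" if "u \<in> K" for u
    using x(2)[OF that] infdist_nonneg[of u L] by linarith
  then show ?thesis
    using in_closed_iff_infdist_zero[OF L'(2,1)] by blast
qed

lemma is_attractor_unique:
  assumes "\<And>f. f \<in> F \<Longrightarrow> contractive_similitude f" "is_attractor F K" "is_attractor F L"
  shows "K = L"
  using is_attractor_subset[of F] assms by (meson subset_antisym)

text \<open>The touching points lie on whole lines: \<open>affine hull {A, B}\<close> is the line through \<open>A\<close> and \<open>B\<close>,
  not just the side of the triangle.\<close>

definition generalised_sierpinski_triangle ::
  "(real^2) set \<Rightarrow> (real^2 \<Rightarrow> real^2) \<Rightarrow> (real^2 \<Rightarrow> real^2) \<Rightarrow> (real^2 \<Rightarrow> real^2) \<Rightarrow>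
   real^2 \<Rightarrow> real^2 \<Rightarrow> real^2 \<Rightarrow> bool" where
  "generalised_sierpinski_triangle K fA fB fC A B C \<longleftrightarrow>
     contractive_similitude fA \<and> contractive_similitude fB \<and> contractive_similitude fC \<and>
     is_attractor {fA, fB, fC} K \<and>
     fA A = A \<and> fB B = B \<and> fC C = C \<and> \<not> collinear {A, B, C} \<and>
     (\<exists>N M P.
        fA ` K \<inter> fB ` K = {N} \<and> fA ` K \<inter> fC ` K = {M} \<and> fB ` K \<inter> fC ` K = {P} \<and>
        fA ` {B, C} = {N, M} \<and> fB ` {A, C} = {N, P} \<and> fC ` {A, B} = {M, P} \<and>
        N \<in> affine hull {A, B} \<and> M \<in> affine hull {A, C} \<and> P \<in> affine hull {B, C})"

text \<open>In the following, \<open>V\<close> is the vertex fixed by the map and \<open>X\<close>, \<open>Y\<close> are the other two.\<close>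

definition non_flip_map :: "real^2 \<Rightarrow> (real^2 \<Rightarrow> real^2) \<Rightarrow> bool" where
  "non_flip_map V f \<longleftrightarrow> (\<exists>s. 0 < s \<and> s < 1 \<and> (\<forall>x. f x = V + s *\<^sub>R (x - V)))"

text \<open>Reflection of the plane in the line through the origin spanned by the unit vector \<open>u\<close>.\<close>

definition linear_reflection :: "(real^2 \<Rightarrow> real^2) \<Rightarrow> bool" where
  "linear_reflection R \<longleftrightarrow> (\<exists>u. norm u = 1 \<and> (\<forall>x. R x = (2 * (x \<bullet> u)) *\<^sub>R u - x))"

definition flip_map :: "real^2 \<Rightarrow> real^2 \<Rightarrow> real^2 \<Rightarrow> (real^2 \<Rightarrow> real^2) \<Rightarrow> bool" where
  "flip_map V X Y f \<longleftrightarrow>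
     (\<exists>s R. 0 < s \<and> s < 1 \<and> linear_reflection R \<and>
        R (sgn (X - V)) = sgn (Y - V) \<and> R (sgn (Y - V)) = sgn (X - V) \<and>
        (\<forall>x. f x = V + s *\<^sub>R R (x - V)))"

datatype map_type = Flip | NonFlip

fun has_map_type :: "map_type \<Rightarrow> real^2 \<Rightarrow> real^2 \<Rightarrow> real^2 \<Rightarrow> (real^2 \<Rightarrow> real^2) \<Rightarrow> bool" where
  "has_map_type Flip V X Y f = flip_map V X Y f"
| "has_map_type NonFlip V X Y f = non_flip_map V f"

text \<open>Types of triangles are considered up to relabelling of the vertices, hence multisets.\<close>

type_synonym triangle_type = "map_type multiset"

definition triangle_NNN :: triangle_type where "triangle_NNN = {#NonFlip, NonFlip, NonFlip#}"
definition triangle_FNN :: triangle_type where "triangle_FNN = {#Flip, NonFlip, NonFlip#}"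
definition triangle_FFN :: triangle_type where "triangle_FFN = {#Flip, Flip, NonFlip#}"
definition triangle_FFF :: triangle_type where "triangle_FFF = {#Flip, Flip, Flip#}"

definition has_triangle_type ::
  "triangle_type \<Rightarrow> (real^2 \<Rightarrow> real^2) \<Rightarrow> (real^2 \<Rightarrow> real^2) \<Rightarrow> (real^2 \<Rightarrow> real^2) \<Rightarrow>
   real^2 \<Rightarrow> real^2 \<Rightarrow> real^2 \<Rightarrow> bool" where
  "has_triangle_type T fA fB fC A B C \<longleftrightarrow>
     (\<exists>a b c. has_map_type a A B C fA \<and> has_map_type b B A C fB \<and> has_map_type c C A B fC \<and>
        T = {#a, b, c#})"

end

theory Submission
  imports Defs
begin

text \<open>Each map carries its two other vertices to points of the adjacent side lines, so up to the signs of
  these points it is determined to be a non-flip or a flip map. The issue is to exclude that a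
  touching point, say \<open>N = A + \<nu> (B - A)\<close>, lies behind \<open>A\<close>. The incidence equations leave a few
  configurations with \<open>\<nu> < 0\<close>, and an area estimate \<open>sA\<^sup>2 + sB\<^sup>2 + sC\<^sup>2 \<le> 1\<close> eliminates all but
  one family: a right angle at \<open>A\<close>, \<open>fA\<close> the reflection in \<open>AC\<close> scaled by \<open>t\<close>, \<open>fC\<close> the
  homothety with ratio \<open>1 - t\<close>, \<open>fB\<close> a flip. There \<open>K\<close> contains the whole side \<open>AC\<close>, and its image under \<open>fB\<close> crosses its
  image under \<open>fA\<close> away from \<open>N\<close>. Conversely, on an equilateral triangle with ratio \<open>1/2\<close> each of
  the three maps can be chosen freely as flip or non-flip, the attractor being the classical gasket.\<close>

subsection \<open>Contractive similitudes\<close>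

text \<open>The ratio is exposed as a parameter, because the incidence equations and the area count
  are stated in terms of it.\<close>

definition similitude :: "real \<Rightarrow> (real^2 \<Rightarrow> real^2) \<Rightarrow> bool" where
  "similitude s f \<longleftrightarrow> (\<exists>Q b. orthogonal_matrix Q \<and> (\<forall>x. f x = s *\<^sub>R (Q *v x) + b))"

lemma contractive_similitude_iff:
  "contractive_similitude f \<longleftrightarrow> (\<exists>s. 0 < s \<and> s < 1 \<and> similitude s f)"
  unfolding contractive_similitude_def similitude_def by blast

lemma similitude_line:
  assumes "similitude s f"
  shows "f (x + t *\<^sub>R (y - z)) = f x + t *\<^sub>R (f y - f z)"
  using assms unfolding similitude_def
  by (auto simp: matrix_vector_right_distrib matrix_vector_mult_diff_distrib matrix_vector_mult_scaleR
      algebra_simps)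

lemma similitude_inner:
  assumes "similitude s f"
  shows "(f x - f z) \<bullet> (f y - f z) = s\<^sup>2 * ((x - z) \<bullet> (y - z))"
proof -
  obtain Q b where Q: "orthogonal_matrix Q" and f: "\<And>x. f x = s *\<^sub>R (Q *v x) + b"
    using assms unfolding similitude_def by blast
  have "orthogonal_transformation ((*v) Q)"
    using Q by (simp add: orthogonal_transformation_matrix)
  then have "(Q *v u) \<bullet> (Q *v v) = u \<bullet> v" for u v
    by (simp add: orthogonal_transformation_def)
  then show ?thesis
    by (simp add: f power2_eq_square flip: scaleR_diff_right matrix_vector_mult_diff_distrib)
qed

lemma similitude_dist:
  assumes "similitude s f" "0 < s"
  shows "dist (f x) (f y) = s * dist x y"
  using similitude_inner[OF assms(1), of x y x] assms(2)
  by (simp add: dist_norm norm_eq_sqrt_inner real_sqrt_mult)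

text \<open>In the plane the linear part \<open>s *\<^sub>R Q\<close> has determinant of absolute
  value \<open>s\<^sup>2\<close>, since \<open>det Q\<close> is 1 or -1.\<close>

lemma similitude_measure:
  assumes f: "similitude s f" and S: "S \<in> lmeasurable"
  shows "f ` S \<in> lmeasurable" "measure lebesgue (f ` S) = s\<^sup>2 * measure lebesgue S"
proof -
  obtain Q b where Q: "orthogonal_matrix Q" and f: "\<And>x. f x = s *\<^sub>R (Q *v x) + b"
    using f unfolding similitude_def by blast
  define L where "L = (\<lambda>x. (s *\<^sub>R Q) *v x)"
  have L: "linear L" and fS: "f ` S = (\<lambda>x. b + x) ` (L ` S)"
    unfolding L_def image_image by (auto simp: f scaleR_matrix_vector_assoc add.commute)
  have "det (s *\<^sub>R Q) = s\<^sup>2 * det Q"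
    by (simp add: det_2 power2_eq_square algebra_simps)
  then have "\<bar>det (matrix L)\<bar> = s\<^sup>2"
    using det_orthogonal_matrix[OF Q] unfolding L_def by (auto simp: abs_mult)
  then show "f ` S \<in> lmeasurable" "measure lebesgue (f ` S) = s\<^sup>2 * measure lebesgue S"
    unfolding fS using measurable_linear_image[OF L S] measure_linear_image[OF L S]
    by (simp_all add: measurable_translation measure_translation)
qed

text \<open>A point of \<open>L\<close> farthest from \<open>K\<close> is the image of another point
  of \<open>L\<close> under a contraction mapping \<open>K\<close> into itself, which shrinks
  distances to \<open>K\<close>; so the maximal distance is 0. This puts fixed points and, later, a
  whole side of the triangle into the attractor.\<close>

lemma self_covered_subset:
  assumes F: "\<And>f. f \<in> F \<Longrightarrow> contractive_similitude f"
    and K: "K \<noteq> {}" "closed K" "\<And>f. f \<in> F \<Longrightarrow> f ` K \<subseteq> K"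
    and L: "compact L" "L \<subseteq> (\<Union>f\<in>F. f ` L)"
  shows "L \<subseteq> K"
proof (cases "L = {}")
  case False
  have "continuous_on L (\<lambda>x. infdist x K)"
    by (intro continuous_intros)
  then obtain x where x: "x \<in> L" "\<And>y. y \<in> L \<Longrightarrow> infdist y K \<le> infdist x K"
    using continuous_attains_sup[OF L(1) False] by blast
  obtain f y where f: "f \<in> F" "y \<in> L" "x = f y"
    using x(1) L(2) by blast
  obtain s where s: "0 < s" "s < 1" "\<And>u v. dist (f u) (f v) = s * dist u v"
    using contractive_similitude_dist[OF F[OF f(1)]] by metis
  obtain z where z: "z \<in> K" "infdist y K = dist y z"
    using infdist_attains_inf[OF K(2,1)] by metis
  have "infdist x K \<le> s * infdist y K"
    using infdist_le[of "f z" K x] K(3)[OF f(1)] z(1) by (force simp: f(3) s(3) z(2))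
  also have "\<dots> \<le> s * infdist x K"
    using x(2)[OF f(2)] s(1) by simp
  finally have "(1 - s) * infdist x K \<le> 0"
    by (simp add: algebra_simps)
  then have "infdist x K \<le> 0"
    using s(2) by (simp add: mult_le_0_iff)
  then have "infdist u K = 0" if "u \<in> L" for u
    using x(2)[OF that] infdist_nonneg[of u K] by linarith
  then show ?thesis
    using in_closed_iff_infdist_zero[OF K(2,1)] by blast
qed simp

subsection \<open>Solving the incidence equations\<close>

text \<open>Here \<open>N = A + \<nu> (B - A)\<close>, \<open>M = A + \<mu> (C - A)\<close>, \<open>P = B + \<pi> (C - B)\<close> and \<open>a\<close>, \<open>b\<close>, \<open>c\<close> are the
  side lengths opposite to \<open>A\<close>, \<open>B\<close>, \<open>C\<close>. In the assumptions for each vertex, the first disjunct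
  means that its map keeps each adjacent side on its line, the second that it exchanges the lines;
  if the two signs at a vertex differ, orthogonality of the linear part forces a right angle.\<close>

lemma signed_ratios_solution:
  fixes a b c sA sB sC \<nu> \<mu> \<pi> :: real
  assumes pos: "0 < a" "0 < b" "0 < c" "0 < sA" "0 < sB" "0 < sC"
    and less1: "sA < 1" "sB < 1" "sC < 1"
    and sum: "sA\<^sup>2 + sB\<^sup>2 + sC\<^sup>2 \<le> 1"
    and A: "\<bar>\<nu>\<bar> = sA \<and> \<bar>\<mu>\<bar> = sA \<or> \<bar>\<nu>\<bar> * c = sA * b \<and> \<bar>\<mu>\<bar> * b = sA * c"
    and B: "\<bar>1 - \<nu>\<bar> = sB \<and> \<bar>\<pi>\<bar> = sB \<or> \<bar>1 - \<nu>\<bar> * c = sB * a \<and> \<bar>\<pi>\<bar> * a = sB * c"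
    and C: "\<bar>1 - \<mu>\<bar> = sC \<and> \<bar>1 - \<pi>\<bar> = sC \<or> \<bar>1 - \<mu>\<bar> * b = sC * a \<and> \<bar>1 - \<pi>\<bar> * a = sC * b"
    and angA: "0 < \<nu> * \<mu> \<or> a\<^sup>2 = b\<^sup>2 + c\<^sup>2"
    and angB: "0 < (1 - \<nu>) * \<pi> \<or> b\<^sup>2 = a\<^sup>2 + c\<^sup>2"
    and angC: "0 < (1 - \<mu>) * (1 - \<pi>) \<or> c\<^sup>2 = a\<^sup>2 + b\<^sup>2"
    and neg: "\<nu> < 0"
  shows "\<bar>1 - \<nu>\<bar> \<noteq> sB" "\<mu> = sA" "\<nu> = - sA" "\<pi> = sA" "sC = 1 - sA"
    "b \<noteq> c" "a \<noteq> b"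
proof -
  \<comment> \<open>The area bound in the form needed: \<open>sB\<^sup>2 + sC\<^sup>2\<close> cannot
    exceed 1, scaled by \<open>a\<^sup>2\<close> to match the equations at \<open>B\<close> and
    \<open>C\<close>.\<close>
  have ne: False if "sB\<^sup>2 * a\<^sup>2 + sC\<^sup>2 * a\<^sup>2 > a\<^sup>2"
  proof -
    have "(sB\<^sup>2 + sC\<^sup>2) * a\<^sup>2 > 1 * a\<^sup>2"
      using that by (simp add: algebra_simps)
    then have "sB\<^sup>2 + sC\<^sup>2 > 1"
      using mult_less_cancel_right_pos[of "a\<^sup>2" 1] pos(1) by (simp add: mult_less_cancel_right)
    then show False
      using sum pos(4) by (smt (verit) zero_le_power2)
  qed
  have sq: "x\<^sup>2 < y\<^sup>2" if "x < y" "0 < x" for x y :: real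
    using that by (simp add: power_strict_mono)
  \<comment> \<open>For negative \<open>\<nu>\<close> the point \<open>N\<close> is farther from
    \<open>B\<close> than \<open>A\<close> is, so the contraction \<open>fB\<close> cannot send
    \<open>A\<close> to it and must exchange the side lines.\<close>
  have B1: "\<bar>1 - \<nu>\<bar> \<noteq> sB"
    using neg less1 by linarith
  then have B2: "(1 - \<nu>) * c = sB * a" "\<bar>\<pi>\<bar> * a = sB * c"
    using B neg by auto
  have ca: "c < a"
  proof -
    have "c < (1 - \<nu>) * c" using neg pos by simp
    also have "\<dots> < a" using B2(1) less1(2) pos by simp
    finally show ?thesis .
  qed
  have pi0: "\<pi> \<noteq> 0"
    using B2(2) pos by auto
  \<comment> \<open>If \<open>M\<close> were behind \<open>A\<close> too, \<open>fC\<close> would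
    also exchange lines, \<open>a\<close> would be the longest side and \<open>P\<close> would lie
    strictly inside \<open>BC\<close>. Splitting \<open>a\<close> at \<open>P\<close> then makes
    \<open>sB\<^sup>2 + sC\<^sup>2\<close> exceed 1.\<close>
  have mu_pos: "0 < \<mu>"
  proof (rule ccontr)
    assume "\<not> 0 < \<mu>"
    moreover have "\<mu> \<noteq> 0"
      using A pos by auto
    ultimately have mu: "\<mu> < 0" by linarith
    have "\<bar>1 - \<mu>\<bar> \<noteq> sC"
      using mu less1 by linarith
    then have C2: "(1 - \<mu>) * b = sC * a" "\<bar>1 - \<pi>\<bar> * a = sC * b"
      using C mu by auto
    have ba: "b < a"
    proof -
      have "b < (1 - \<mu>) * b" using mu pos by simp
      also have "\<dots> < a" using C2(1) less1(3) pos by simp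
      finally show ?thesis .
    qed
    have "0 < (1 - \<nu>) * \<pi>"
      using angB sq[OF ba] pos by (smt (verit) zero_le_power2)
    then have pi: "0 < \<pi>"
      using neg by (simp add: zero_less_mult_iff)
    have "0 < (1 - \<mu>) * (1 - \<pi>)"
      using angC sq[OF ca] pos by (smt (verit) zero_le_power2)
    then have pi1: "0 < 1 - \<pi>"
      using mu by (simp add: zero_less_mult_iff)
    have a: "a = sB * c + sC * b"
      using B2(2) C2(2) pi pi1 by (simp add: algebra_simps)
    have "a\<^sup>2 = (sB * a) * c + (sC * a) * b"
      unfolding power2_eq_square by (subst (2) a) (simp add: algebra_simps)
    also have "\<dots> = (1 - \<nu>) * c\<^sup>2 + (1 - \<mu>) * b\<^sup>2"
      unfolding B2(1)[symmetric] C2(1)[symmetric] by (simp add: power2_eq_square)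
    also have "\<dots> < (1 - \<nu>)\<^sup>2 * c\<^sup>2 + (1 - \<mu>)\<^sup>2 * b\<^sup>2"
      using neg mu pos by (intro add_strict_mono mult_strict_right_mono) (auto simp: power2_eq_square)
    also have "\<dots> = sB\<^sup>2 * a\<^sup>2 + sC\<^sup>2 * a\<^sup>2"
      by (simp add: B2(1) C2(1) flip: power_mult_distrib)
    finally show False
      using ne by simp
  qed
  \<comment> \<open>The signs at \<open>A\<close> differ, so the angle at \<open>A\<close> is right;
    those at \<open>B\<close> and \<open>C\<close> are then not, which fixes the remaining
    signs.\<close>
  then have pyth: "a\<^sup>2 = b\<^sup>2 + c\<^sup>2"
    using angA neg by (simp add: zero_less_mult_iff)
  have "b\<^sup>2 \<noteq> a\<^sup>2 + c\<^sup>2"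
    using pyth pos by (smt (verit) zero_less_power2)
  then have pi_pos: "0 < \<pi>"
    using angB neg by (simp add: zero_less_mult_iff)
  have "c\<^sup>2 \<noteq> a\<^sup>2 + b\<^sup>2"
    using pyth pos by (smt (verit) zero_less_power2)
  then have sgnC: "0 < (1 - \<mu>) * (1 - \<pi>)"
    using angC by simp
  have pi: "\<pi> < 1"
  proof -
    have "\<pi> * a < 1 * a"
      using B2(2) pi_pos ca less1(2) pos by (smt (verit) mult_less_cancel_right1)
    then show ?thesis
      using pos(1) by (simp add: mult_less_cancel_right)
  qed
  have mu: "\<mu> < 1"
    using sgnC pi by (simp add: zero_less_mult_iff)
  have P: "\<pi> * a = sB * c"
    using B2(2) pi_pos by simp
  \<comment> \<open>Eliminates \<open>sB\<close> from the two equations at \<open>B\<close>.\<close>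
  have P2: "\<pi> * a\<^sup>2 = (1 - \<nu>) * c\<^sup>2"
    using B2(1) P by (simp add: power2_eq_square) (metis mult.commute mult.left_commute)
  have sBa: "sB\<^sup>2 * a\<^sup>2 = (1 - \<nu>)\<^sup>2 * c\<^sup>2"
    by (simp add: B2(1) flip: power_mult_distrib)
  have sBC: "sB\<^sup>2 * a\<^sup>2 + sC\<^sup>2 * a\<^sup>2 = (1 - \<nu>)\<^sup>2 * c\<^sup>2 + (1 - \<mu>)\<^sup>2 * b\<^sup>2"
    if "(1 - \<mu>) * b = sC * a"
    using sBa that by (simp flip: power_mult_distrib)
  \<comment> \<open>Four combinations of keeping or exchanging lines at \<open>A\<close> and
    \<open>C\<close>. Keeping at both gives the claimed family; exchanging at \<open>A\<close> only
    forces \<open>\<mu> = 1\<close>; in the two where \<open>fC\<close> exchanges lines the area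
    bound fails.\<close>
  have sol: "\<mu> = sA \<and> \<nu> = - sA \<and> \<pi> = sA \<and> sC = 1 - sA"
    using A
  proof
    assume "\<bar>\<nu>\<bar> = sA \<and> \<bar>\<mu>\<bar> = sA"
    then have A1: "\<nu> = - sA" "\<mu> = sA"
      using neg mu_pos by auto
    show ?thesis
      using C
    proof
      assume "\<bar>1 - \<mu>\<bar> = sC \<and> \<bar>1 - \<pi>\<bar> = sC"
      then show ?thesis
        using A1 mu pi by auto
    next
      assume "\<bar>1 - \<mu>\<bar> * b = sC * a \<and> \<bar>1 - \<pi>\<bar> * a = sC * b"
      then have C2: "(1 - \<mu>) * b = sC * a" "(1 - \<pi>) * a = sC * b"
        using mu pi by auto
      have "(1 - \<pi>) * a\<^sup>2 = (1 - \<mu>) * b\<^sup>2"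
        using C2 by (simp add: power2_eq_square) (metis mult.commute mult.left_commute)
      then have "sA * (c\<^sup>2 - b\<^sup>2) = 0"
        using P2 pyth A1 by (auto simp: algebra_simps)
      then have "c\<^sup>2 = b\<^sup>2"
        using pos by simp
      then have "sB\<^sup>2 * a\<^sup>2 + sC\<^sup>2 * a\<^sup>2 = a\<^sup>2 + sA\<^sup>2 * a\<^sup>2"
        using sBC[OF C2(1)] A1 by (simp add: pyth) (simp add: power2_eq_square algebra_simps)
      then show ?thesis
        using ne pos by simp
    qed
  next
    assume "\<bar>\<nu>\<bar> * c = sA * b \<and> \<bar>\<mu>\<bar> * b = sA * c"
    then have A2: "- \<nu> * c = sA * b" "\<mu> * b = sA * c"
      using neg mu_pos by auto
    have nm: "- \<nu> * c\<^sup>2 = \<mu> * b\<^sup>2"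
      using A2 by (simp add: power2_eq_square) (metis mult.commute mult.left_commute minus_mult_left)
    show ?thesis
      using C
    proof
      assume "\<bar>1 - \<mu>\<bar> = sC \<and> \<bar>1 - \<pi>\<bar> = sC"
      then have "\<pi> = \<mu>"
        using mu pi by auto
      then have "\<mu> * b\<^sup>2 + \<mu> * c\<^sup>2 = c\<^sup>2 + - \<nu> * c\<^sup>2"
        using P2 pyth by (simp add: algebra_simps)
      then have "(1 - \<mu>) * c\<^sup>2 = 0"
        unfolding nm by (simp add: algebra_simps)
      then show ?thesis
        using mu pos by simp
    next
      assume "\<bar>1 - \<mu>\<bar> * b = sC * a \<and> \<bar>1 - \<pi>\<bar> * a = sC * b"
      then have "(1 - \<mu>) * b = sC * a"
        using mu by auto
      note eq = sBC[OF this]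
      have "(1 - \<nu>)\<^sup>2 * c\<^sup>2 + (1 - \<mu>)\<^sup>2 * b\<^sup>2 =
          (b\<^sup>2 + c\<^sup>2) + 2 * (- \<nu> * c\<^sup>2 - \<mu> * b\<^sup>2) + \<nu>\<^sup>2 * c\<^sup>2 + \<mu>\<^sup>2 * b\<^sup>2"
        by (simp add: power2_eq_square algebra_simps)
      \<comment> \<open>By \<open>nm\<close> the terms linear in \<open>\<nu>\<close> and
        \<open>\<mu>\<close> cancel, leaving a positive excess over
        \<open>a\<^sup>2\<close>.\<close>
      also have "\<dots> = a\<^sup>2 + \<nu>\<^sup>2 * c\<^sup>2 + \<mu>\<^sup>2 * b\<^sup>2"
        unfolding nm pyth by simp
      finally have "sB\<^sup>2 * a\<^sup>2 + sC\<^sup>2 * a\<^sup>2 = a\<^sup>2 + \<nu>\<^sup>2 * c\<^sup>2 + \<mu>\<^sup>2 * b\<^sup>2"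
        unfolding eq .
      moreover have "0 < \<nu>\<^sup>2 * c\<^sup>2" "0 \<le> \<mu>\<^sup>2 * b\<^sup>2"
        using neg pos by auto
      ultimately have "a\<^sup>2 < sB\<^sup>2 * a\<^sup>2 + sC\<^sup>2 * a\<^sup>2"
        by linarith
      then show ?thesis
        using ne by blast
    qed
  qed
  have "sA * b\<^sup>2 = c\<^sup>2"
    using P2 pyth sol by (simp add: algebra_simps)
  then show "b \<noteq> c"
    using less1(1) pos by auto
  show "a \<noteq> b"
    using pyth pos by auto
  show "\<bar>1 - \<nu>\<bar> \<noteq> sB" "\<mu> = sA" "\<nu> = - sA" "\<pi> = sA" "sC = 1 - sA"
    using B1 sol by auto
qed

subsection \<open>The area estimate\<close>

text \<open>The attractor itself may have area zero, so areas are compared on its open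
  \<open>e\<close>-neighbourhood for small \<open>e\<close>.\<close>

definition neighbourhood :: "real \<Rightarrow> 'a::metric_space set \<Rightarrow> 'a set" where
  "neighbourhood e S = (\<Union>x\<in>S. ball x e)"

lemma neighbourhood_mono: "S \<subseteq> T \<Longrightarrow> neighbourhood e S \<subseteq> neighbourhood e T"
  by (auto simp: neighbourhood_def)

lemma neighbourhood_Un: "neighbourhood e (S \<union> T) = neighbourhood e S \<union> neighbourhood e T"
  by (auto simp: neighbourhood_def)

lemma lmeasurable_neighbourhood:
  fixes S :: "'a::euclidean_space set"
  assumes "bounded S"
  shows "neighbourhood e S \<in> lmeasurable"
proof (rule lmeasurable_open)
  obtain r where "S \<subseteq> ball 0 r"
    using assms bounded_subset_ballD by blast
  then have "neighbourhood e S \<subseteq> ball 0 (r + e)"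
    unfolding neighbourhood_def
    by (auto simp: subset_iff) (smt (verit) dist_norm norm_minus_commute norm_triangle_sub)
  then show "bounded (neighbourhood e S)"
    using bounded_ball bounded_subset by blast
qed (auto simp: neighbourhood_def)

lemma measure_neighbourhood_pos:
  fixes S :: "'a::euclidean_space set"
  assumes "bounded S" "S \<noteq> {}" "0 < e"
  shows "0 < measure lebesgue (neighbourhood e S)"
proof -
  obtain x where "x \<in> S"
    using assms by blast
  then have "measure lebesgue (ball x e) \<le> measure lebesgue (neighbourhood e S)"
    by (intro measure_mono_fmeasurable lmeasurable_neighbourhood assms) (auto simp: neighbourhood_def)
  moreover have "0 < measure lebesgue (ball x e)"
    using assms(3) by (simp add: content_ball_pos)
  ultimately show ?thesis by linarith
qed

lemma eventually_disjoint_neighbourhoods: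
  fixes S T :: "'a::heine_borel set"
  assumes "compact S" "compact T" "S \<inter> T = {}"
  shows "\<forall>\<^sub>F e in at_right 0. neighbourhood e S \<inter> neighbourhood e T = {}"
proof -
  obtain d where d: "0 < d" "\<And>x y. x \<in> S \<Longrightarrow> y \<in> T \<Longrightarrow> d \<le> dist x y"
    using separate_compact_closed[OF assms(1) compact_imp_closed[OF assms(2)] assms(3)] by blast
  have "neighbourhood e S \<inter> neighbourhood e T = {}" if "e < d / 2" for e
  proof (rule ccontr)
    assume "neighbourhood e S \<inter> neighbourhood e T \<noteq> {}"
    then obtain x y z where "x \<in> S" "y \<in> T" "dist x z < e" "dist y z < e"
      unfolding neighbourhood_def by auto
    then show False
      using d(2)[of x y] that dist_triangle2[of x y z] by linarith
  qed
  then show ?thesis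
    unfolding eventually_at_right_field using d(1) by (intro exI[of _ "d / 2"]) auto
qed

lemma similitude_inj:
  assumes "similitude s f" "0 < s"
  shows "inj f"
  using similitude_dist[OF assms] assms(2) by (metis dist_eq_0_iff injI mult_eq_0_iff less_irrefl)

lemma similitude_continuous:
  assumes "similitude s f" "0 < s"
  shows "continuous_on S f"
proof -
  have "s-lipschitz_on S f"
    using similitude_dist[OF assms] assms(2) by (intro lipschitz_onI) auto
  then show ?thesis
    by (rule lipschitz_on_continuous_on)
qed

text \<open>Keeping the radius \<open>e\<close>, rather than \<open>s * e\<close>, lets the
  inclusion be iterated with a single radius.\<close>

lemma similitude_neighbourhood:
  assumes "similitude s f" "0 < s" "s < 1"
  shows "f ` neighbourhood e S \<subseteq> neighbourhood e (f ` S)"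
proof clarsimp
  fix y assume "y \<in> neighbourhood e S"
  then obtain x where x: "x \<in> S" "dist x y < e"
    unfolding neighbourhood_def by auto
  have "s * dist x y \<le> 1 * dist x y"
    using assms(3) by (intro mult_right_mono) auto
  then have "dist (f x) (f y) < e"
    using x(2) similitude_dist[OF assms(1,2), of x y] by simp
  then show "f y \<in> neighbourhood e (f ` S)"
    using x(1) by (auto simp: neighbourhood_def)
qed

text \<open>Ratios and touching points are parameters, so that relabelled copies can be interpreted.
  \<open>P\<close> is the point called O in the informal definition.\<close>

locale sierpinski_triangle =
  fixes K :: "(real^2) set" and fA fB fC :: "real^2 \<Rightarrow> real^2" and A B C :: "real^2"
    and sA sB sC :: real and N M P :: "real^2"
  assumes sim: "similitude sA fA" "similitude sB fB" "similitude sC fC"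
    and pos: "0 < sA" "0 < sB" "0 < sC"
    and less1: "sA < 1" "sB < 1" "sC < 1"
    and attractor: "is_attractor {fA, fB, fC} K"
    and fixed: "fA A = A" "fB B = B" "fC C = C"
    and triangle: "\<not> collinear {A, B, C}"
    and touch: "fA ` K \<inter> fB ` K = {N}" "fA ` K \<inter> fC ` K = {M}" "fB ` K \<inter> fC ` K = {P}"
    and corners: "fA ` {B, C} = {N, M}" "fB ` {A, C} = {N, P}" "fC ` {A, B} = {M, P}"
    and lines: "N \<in> affine hull {A, B}" "M \<in> affine hull {A, C}" "P \<in> affine hull {B, C}"

lemma generalised_sierpinski_triangle_iff:
  "generalised_sierpinski_triangle K fA fB fC A B C \<longleftrightarrow>
    (\<exists>sA sB sC N M P. sierpinski_triangle K fA fB fC A B C sA sB sC N M P)"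
  unfolding generalised_sierpinski_triangle_def sierpinski_triangle_def contractive_similitude_iff
  by blast

text \<open>This transposition and the next generate all relabellings, so whatever is shown at
  \<open>A\<close> transfers to the other vertices.\<close>

lemma sierpinski_triangle_swap_AB:
  "sierpinski_triangle K fA fB fC A B C sA sB sC N M P \<Longrightarrow>
    sierpinski_triangle K fB fA fC B A C sB sA sC N P M"
  unfolding sierpinski_triangle_def by (auto simp: insert_commute Int_commute)

lemma sierpinski_triangle_swap_BC:
  "sierpinski_triangle K fA fB fC A B C sA sB sC N M P \<Longrightarrow>
    sierpinski_triangle K fA fC fB A C B sA sC sB M N P"
  unfolding sierpinski_triangle_def by (auto simp: insert_commute Int_commute)

context sierpinski_triangle
begin

lemma K: "K \<noteq> {}" "compact K" "K = fA ` K \<union> fB ` K \<union> fC ` K"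
  using attractor unfolding is_attractor_def by auto

lemma contractive: "f \<in> {fA, fB, fC} \<Longrightarrow> contractive_similitude f"
  using sim pos less1 contractive_similitude_iff by blast

lemma image_subset: "f \<in> {fA, fB, fC} \<Longrightarrow> f ` K \<subseteq> K"
  using K(3) by blast

lemma vertices_distinct: "A \<noteq> B" "A \<noteq> C" "B \<noteq> C"
  using triangle by (auto simp: insert_commute)

lemma vertex_in: "A \<in> K"
  using self_covered_subset[of "{fA, fB, fC}" K "{A}"] contractive image_subset K(1,2) fixed(1)
  by (auto simp: compact_imp_closed)

text \<open>Otherwise \<open>A\<close> would be the common point \<open>N\<close> of two pieces; but
  \<open>N\<close> is the image under \<open>fA\<close> of another vertex, while \<open>fA\<close>
  is injective and fixes \<open>A\<close>.\<close>

lemma vertex_notin: "A \<notin> fB ` K"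
proof
  assume "A \<in> fB ` K"
  moreover have "A \<in> fA ` K"
    using vertex_in fixed(1) by force
  ultimately have "A \<in> fA ` {B, C}"
    using touch(1) corners(1) by auto
  then show False
    using similitude_inj[OF sim(1) pos(1)] fixed(1) vertices_distinct by (metis inj_image_mem_iff insert_iff singletonD)
qed

end

lemma (in sierpinski_triangle) vertices_notin:
  "A \<notin> fB ` K" "A \<notin> fC ` K" "B \<notin> fA ` K" "B \<notin> fC ` K" "C \<notin> fA ` K" "C \<notin> fB ` K"
proof -
  interpret BAC: sierpinski_triangle K fB fA fC B A C sB sA sC N P M
    by (rule sierpinski_triangle_swap_AB) unfold_locales
  interpret ACB: sierpinski_triangle K fA fC fB A C B sA sC sB M N P
    by (rule sierpinski_triangle_swap_BC) unfold_locales
  interpret BCA: sierpinski_triangle K fB fC fA B C A sB sC sA P N M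
    by (rule sierpinski_triangle_swap_BC) unfold_locales
  interpret CAB: sierpinski_triangle K fC fA fB C A B sC sA sB M P N
    by (rule sierpinski_triangle_swap_AB) unfold_locales
  interpret CBA: sierpinski_triangle K fC fB fA C B A sC sB sA P M N
    by (rule sierpinski_triangle_swap_BC) unfold_locales
  show "A \<notin> fB ` K" "A \<notin> fC ` K" "B \<notin> fA ` K" "B \<notin> fC ` K" "C \<notin> fA ` K" "C \<notin> fB ` K"
    by (fact vertex_notin ACB.vertex_notin BAC.vertex_notin BCA.vertex_notin CAB.vertex_notin
        CBA.vertex_notin)+
qed

section \<open>Areas of iterated thickened pieces\<close>

context sierpinski_triangle
begin

text \<open>The Hutchinson operator of the system, with \<open>K\<close> as a fixed point.\<close>

definition step :: "(real^2) set \<Rightarrow> (real^2) set" where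
  "step X = fA ` X \<union> fB ` X \<union> fC ` X"

lemma step_subset: "X \<subseteq> K \<Longrightarrow> step X \<subseteq> K"
  unfolding step_def using image_subset by blast

text \<open>A vertex has only one address, so the cylinder sets of level \<open>n\<close> touching one another at
  \<open>N\<close>, \<open>M\<close> or \<open>P\<close> end in a constant run. Starting from \<open>fA ` fB ` K\<close> instead of \<open>K\<close> avoids
  them and makes the pieces of all levels disjoint.\<close>

lemma iterate_core:
  "compact ((step ^^ n) (fA ` fB ` K)) \<and> (step ^^ n) (fA ` fB ` K) \<subseteq> K \<and>
    {A, B, C} \<inter> (step ^^ n) (fA ` fB ` K) = {}"
proof (induction n)
  case 0
  have "A \<notin> fA ` fB ` K"
    using vertices_notin(1) similitude_inj[OF sim(1) pos(1)] fixed(1)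
    by (metis inj_image_mem_iff)
  moreover have "fA ` fB ` K \<subseteq> fA ` K" "fA ` K \<subseteq> K"
    using K(3) by blast+
  moreover have "compact (fA ` fB ` K)"
    using K(2) sim pos by (auto intro!: compact_continuous_image similitude_continuous)
  ultimately show ?case
    using vertices_notin(3,5) by auto
next
  case (Suc n)
  define X where "X = (step ^^ n) (fA ` fB ` K)"
  have X: "compact X" "X \<subseteq> K" "A \<notin> X" "B \<notin> X" "C \<notin> X"
    using Suc by (auto simp: X_def)
  have "compact (step X)"
    unfolding step_def using sim pos X(1)
    by (auto intro!: compact_Un compact_continuous_image similitude_continuous)
  moreover have "A \<notin> fA ` X" "B \<notin> fB ` X" "C \<notin> fC ` X"
    using X(3-) fixed sim pos by (metis inj_image_mem_iff similitude_inj)+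
  then have "A \<notin> step X" "B \<notin> step X" "C \<notin> step X"
    using X(2) vertices_notin unfolding step_def by blast+
  ultimately show ?case
    using step_subset[OF X(2)] by (auto simp: X_def)
qed

text \<open>The pieces of \<open>K\<close> meet only at \<open>N\<close>, \<open>M\<close> and
  \<open>P\<close>. These are images of vertices, and \<open>X\<close> contains no vertex, so
  injectivity removes them.\<close>

lemma iterate_core_disjoint:
  fixes n
  defines "X \<equiv> (step ^^ n) (fA ` fB ` K)"
  shows "fA ` X \<inter> fB ` X = {}" "fA ` X \<inter> fC ` X = {}" "fB ` X \<inter> fC ` X = {}"
proof -
  have X: "X \<subseteq> K" "A \<notin> X" "B \<notin> X" "C \<notin> X"
    using iterate_core unfolding X_def by auto
  have A: "N \<notin> fA ` X" "M \<notin> fA ` X" and B: "P \<notin> fB ` X"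
  proof -
    have "fA ` {B, C} \<inter> fA ` X = {}" "fB ` {A, C} \<inter> fB ` X = {}"
      using X(2-) similitude_inj[OF sim(1) pos(1)] similitude_inj[OF sim(2) pos(2)]
      by (auto simp: inj_eq)
    then show "N \<notin> fA ` X" "M \<notin> fA ` X" "P \<notin> fB ` X"
      unfolding corners by auto
  qed
  have "fA ` X \<inter> fB ` X \<subseteq> {N}" "fA ` X \<inter> fC ` X \<subseteq> {M}" "fB ` X \<inter> fC ` X \<subseteq> {P}"
    using X(1) touch by blast+
  then show "fA ` X \<inter> fB ` X = {}" "fA ` X \<inter> fC ` X = {}" "fB ` X \<inter> fC ` X = {}"
    using A B by blast+
qed

lemma step_neighbourhood:
  assumes "X \<subseteq> neighbourhood e Y"
  shows "fA ` X \<subseteq> neighbourhood e (fA ` Y)" "fB ` X \<subseteq> neighbourhood e (fB ` Y)"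
    "fC ` X \<subseteq> neighbourhood e (fC ` Y)" "step X \<subseteq> neighbourhood e (step Y)"
proof -
  show "fA ` X \<subseteq> neighbourhood e (fA ` Y)" "fB ` X \<subseteq> neighbourhood e (fB ` Y)"
    "fC ` X \<subseteq> neighbourhood e (fC ` Y)"
    by (rule subset_trans[OF image_mono[OF assms] similitude_neighbourhood];
        use sim pos less1 in blast)+
  then show "step X \<subseteq> neighbourhood e (step Y)"
    unfolding step_def neighbourhood_Un by blast
qed

lemma iterate_neighbourhood:
  "(step ^^ n) (fA ` fB ` neighbourhood e K) \<subseteq> neighbourhood e ((step ^^ n) (fA ` fB ` K))"
proof (induction n)
  case 0
  have "fB ` neighbourhood e K \<subseteq> neighbourhood e (fB ` K)"
    by (rule step_neighbourhood) simp
  then show ?case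
    using step_neighbourhood(1) by simp
next
  case (Suc n)
  then show ?case
    using step_neighbourhood(4) by simp
qed

text \<open>Each step multiplies the area by the sum of the squared ratios once the three images are
  disjoint. They lie in \<open>e\<close>-neighbourhoods of disjoint compact sets, so this holds for
  small \<open>e\<close>; how small depends on \<open>n\<close>. The factor
  \<open>(sA * sB)\<^sup>2\<close> is the price of starting from the core.\<close>

lemma measure_iterate:
  "\<forall>\<^sub>F e in at_right 0. (step ^^ n) (fA ` fB ` neighbourhood e K) \<in> lmeasurable \<and>
     measure lebesgue ((step ^^ n) (fA ` fB ` neighbourhood e K)) =
       (sA\<^sup>2 + sB\<^sup>2 + sC\<^sup>2) ^ n * (sA * sB)\<^sup>2 * measure lebesgue (neighbourhood e K)"
proof (induction n)
  case 0
  then show ?case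
    using lmeasurable_neighbourhood[OF compact_imp_bounded[OF K(2)]]
    by (simp add: similitude_measure[OF sim(1)] similitude_measure[OF sim(2)] power_mult_distrib)
next
  case (Suc n)
  define X where "X = (step ^^ n) (fA ` fB ` K)"
  have X: "compact (fA ` X)" "compact (fB ` X)" "compact (fC ` X)"
    using iterate_core[of n] sim pos unfolding X_def
    by (auto intro!: compact_continuous_image similitude_continuous)
  have "\<forall>\<^sub>F e in at_right 0. neighbourhood e (fA ` X) \<inter> neighbourhood e (fB ` X) = {}"
    "\<forall>\<^sub>F e in at_right 0. neighbourhood e (fA ` X) \<inter> neighbourhood e (fC ` X) = {}"
    "\<forall>\<^sub>F e in at_right 0. neighbourhood e (fB ` X) \<inter> neighbourhood e (fC ` X) = {}"
    using X iterate_core_disjoint[of n, folded X_def]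
    by (simp_all add: eventually_disjoint_neighbourhoods)
  with Suc show ?case
  proof eventually_elim
    case (elim e)
    define U where "U = (step ^^ n) (fA ` fB ` neighbourhood e K)"
    have U: "U \<in> lmeasurable" and mU: "measure lebesgue U =
        (sA\<^sup>2 + sB\<^sup>2 + sC\<^sup>2) ^ n * (sA * sB)\<^sup>2 * measure lebesgue (neighbourhood e K)"
      using elim(1) by (auto simp: U_def)
    have "U \<subseteq> neighbourhood e X"
      unfolding U_def X_def by (rule iterate_neighbourhood)
    from step_neighbourhood[OF this]
    have fAB: "fA ` U \<inter> fB ` U = {}" "fA ` U \<inter> fC ` U = {}" "fB ` U \<inter> fC ` U = {}"
      using elim(2-4) by blast+
    note m = similitude_measure[OF sim(1) U] similitude_measure[OF sim(2) U]
      similitude_measure[OF sim(3) U]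
    have "measure lebesgue (step U) =
        measure lebesgue (fA ` U \<union> fB ` U) + measure lebesgue (fC ` U)"
      unfolding step_def using m fAB(2,3) by (subst measure_Un3) (auto simp: fmeasurable.Un Int_Un_distrib2)
    also have "measure lebesgue (fA ` U \<union> fB ` U) =
        measure lebesgue (fA ` U) + measure lebesgue (fB ` U)"
      using m fAB(1) by (subst measure_Un3) auto
    finally have "measure lebesgue (step U) = (sA\<^sup>2 + sB\<^sup>2 + sC\<^sup>2) * measure lebesgue U"
      using m by (simp add: algebra_simps)
    moreover have "step U \<in> lmeasurable"
      unfolding step_def using m by (simp add: fmeasurable.Un)
    ultimately show ?case
      by (simp add: mU flip: U_def)
  qed
qed

text \<open>Otherwise, for \<open>n\<close> large enough to beat the constant factor, the iterate
  would have a larger area than the neighbourhood of \<open>K\<close> containing it.\<close>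

lemma sum_squares_le_1: "sA\<^sup>2 + sB\<^sup>2 + sC\<^sup>2 \<le> 1"
proof (rule ccontr)
  assume "\<not> ?thesis"
  moreover have c: "0 < (sA * sB)\<^sup>2"
    using pos by simp
  ultimately obtain n where n: "1 / (sA * sB)\<^sup>2 < (sA\<^sup>2 + sB\<^sup>2 + sC\<^sup>2) ^ n"
    using real_arch_pow by (metis not_le)
  \<comment> \<open>The radius is chosen after \<open>n\<close>, since the admissible radii depend
    on \<open>n\<close>.\<close>
  have "\<forall>\<^sub>F e in at_right 0. 0 < (e::real)"
    by (simp add: eventually_at_right_less)
  then obtain e where e: "0 < e" and me: "(step ^^ n) (fA ` fB ` neighbourhood e K) \<in> lmeasurable"
    "measure lebesgue ((step ^^ n) (fA ` fB ` neighbourhood e K)) =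
       (sA\<^sup>2 + sB\<^sup>2 + sC\<^sup>2) ^ n * (sA * sB)\<^sup>2 * measure lebesgue (neighbourhood e K)"
    using eventually_happens'[OF trivial_limit_at_right_real
        eventually_conj[OF _ measure_iterate[of n]]] by blast
  have "(step ^^ n) (fA ` fB ` neighbourhood e K) \<subseteq> neighbourhood e K"
    by (rule subset_trans[OF iterate_neighbourhood neighbourhood_mono]) (use iterate_core in blast)
  then have "measure lebesgue ((step ^^ n) (fA ` fB ` neighbourhood e K))
      \<le> measure lebesgue (neighbourhood e K)"
    using me(1) lmeasurable_neighbourhood[OF compact_imp_bounded[OF K(2)]]
    by (intro measure_mono_fmeasurable) (auto simp: fmeasurableD)
  then have "(sA\<^sup>2 + sB\<^sup>2 + sC\<^sup>2) ^ n * (sA * sB)\<^sup>2 \<le> 1"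
    using me(2) measure_neighbourhood_pos[OF compact_imp_bounded[OF K(2)] K(1) e]
    by (simp add: mult_le_cancel_right1)
  then show False
    using n c by (simp add: divide_less_eq)
qed

end

subsection \<open>Touching points lie ahead of the vertices\<close>

lemma basis_expansion:
  fixes u v z :: "real^2"
  assumes "\<not> collinear {0, u, v}"
  obtains \<alpha> \<beta> where "z = \<alpha> *\<^sub>R u + \<beta> *\<^sub>R v"
proof -
  define D where "D = u$1 * v$2 - u$2 * v$1"
  have "D \<noteq> 0"
  proof
    assume D: "D = 0"
    have "u \<noteq> 0"
      using assms by (auto simp: collinear_lemma)
    then consider "u$1 \<noteq> 0" | "u$2 \<noteq> 0"
      by (auto simp: vec_eq_iff forall_2)
    then have "\<exists>k. v = k *\<^sub>R u"
    proof cases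
      case 1
      then show ?thesis
        using D by (intro exI[of _ "v$1 / u$1"]) (auto simp: vec_eq_iff forall_2 D_def field_simps)
    next
      case 2
      then show ?thesis
        using D by (intro exI[of _ "v$2 / u$2"]) (auto simp: vec_eq_iff forall_2 D_def field_simps)
    qed
    then show False
      using assms by (auto simp: collinear_lemma)
  qed
  \<comment> \<open>Cramer's rule with the nonzero determinant \<open>D\<close>.\<close>
  then have "z = ((z$1 * v$2 - z$2 * v$1) / D) *\<^sub>R u + ((u$1 * z$2 - u$2 * z$1) / D) *\<^sub>R v"
    unfolding vec_eq_iff forall_2
    by (simp add: add_divide_distrib[symmetric] nonzero_eq_divide_eq) (simp add: D_def algebra_simps)
  then show ?thesis by (rule that)
qed

lemma similitude_expansion:
  assumes "similitude s f"
  shows "f (V + \<alpha> *\<^sub>R (X - V) + \<beta> *\<^sub>R (Y - V)) = f V + \<alpha> *\<^sub>R (f X - f V) + \<beta> *\<^sub>R (f Y - f V)"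
  by (simp add: similitude_line[OF assms])

text \<open>The axis bisects the angle between the two unit vectors; the computation rests on
  \<open>(norm (p + q))\<^sup>2 = 2 * (p \<bullet> (p + q))\<close>.\<close>

lemma reflection_swap:
  fixes p q :: "'a::real_inner"
  assumes "norm p = 1" "norm q = 1" "p + q \<noteq> 0"
  shows "(2 * (p \<bullet> sgn (p + q))) *\<^sub>R sgn (p + q) - p = q"
proof -
  have pq: "p \<bullet> p = 1" "q \<bullet> q = 1"
    using assms by (auto simp: dot_square_norm)
  have "(norm (p + q))\<^sup>2 = 2 * (p \<bullet> (p + q))"
    by (simp add: power2_norm_eq_inner algebra_simps inner_commute pq)
  moreover have "(2 * (p \<bullet> sgn (p + q))) *\<^sub>R sgn (p + q)
      = (2 * (p \<bullet> (p + q)) / (norm (p + q))\<^sup>2) *\<^sub>R (p + q)"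
    unfolding sgn_div_norm by (simp add: power2_eq_square divide_inverse mult_ac)
  ultimately have "(2 * (p \<bullet> sgn (p + q))) *\<^sub>R sgn (p + q) = p + q"
    using assms(3) by (metis divide_self_if norm_eq_zero power_eq_0_iff scaleR_one)
  then show ?thesis by simp
qed

lemma linear_reflection_linear:
  assumes "linear_reflection R"
  shows "linear R"
proof -
  obtain u where "\<And>x. R x = (2 * (x \<bullet> u)) *\<^sub>R u - x"
    using assms unfolding linear_reflection_def by blast
  then have "R = (\<lambda>x. (2 * (x \<bullet> u)) *\<^sub>R u - x)"
    by blast
  then show ?thesis
    by (auto intro!: linearI simp: algebra_simps)
qed

lemma non_collinear_imp_distinct:
  assumes "\<not> collinear {V, X, Y}"
  shows "X \<noteq> V" "Y \<noteq> V" "X \<noteq> Y"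
  using assms by (auto simp: insert_commute)

lemma swapping_reflection_exists:
  fixes V X Y :: "real^2"
  assumes "\<not> collinear {V, X, Y}"
  obtains R where "linear_reflection R" "R (sgn (X - V)) = sgn (Y - V)" "R (sgn (Y - V)) = sgn (X - V)"
proof -
  define p q where "p = sgn (X - V)" and "q = sgn (Y - V)"
  have pq: "norm p = 1" "norm q = 1"
    using non_collinear_imp_distinct[OF assms] by (auto simp: p_def q_def norm_sgn)
  \<comment> \<open>Opposite unit directions would put the three points on one line.\<close>
  have "p + q \<noteq> 0"
  proof
    assume "p + q = 0"
    then have "norm (X - V) *\<^sub>R q = - (norm (X - V) *\<^sub>R p)"
      by (simp add: eq_neg_iff_add_eq_0 add.commute flip: scaleR_add_right scaleR_minus_right)
    also have "norm (X - V) *\<^sub>R p = X - V"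
      using non_collinear_imp_distinct(1)[OF assms] by (simp add: p_def sgn_div_norm)
    finally have "X - V = (- norm (X - V) / norm (Y - V)) *\<^sub>R (Y - V)"
      by (simp add: q_def sgn_div_norm field_simps)
    then have "collinear {0, Y - V, X - V}"
      unfolding collinear_lemma by blast
    then have "collinear {Y, V, X}"
      by (subst collinear_3) auto
    then show False
      using assms by (simp add: insert_commute)
  qed
  show ?thesis
  proof (rule that[of "\<lambda>x. (2 * (x \<bullet> sgn (p + q))) *\<^sub>R sgn (p + q) - x"])
    show "linear_reflection (\<lambda>x. (2 * (x \<bullet> sgn (p + q))) *\<^sub>R sgn (p + q) - x)"
      using \<open>p + q \<noteq> 0\<close> unfolding linear_reflection_def
      by (intro exI[of _ "sgn (p + q)"]) (simp add: norm_sgn)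
  qed (use reflection_swap[OF pq \<open>p + q \<noteq> 0\<close>] reflection_swap[OF pq(2,1)] \<open>p + q \<noteq> 0\<close>
      in \<open>simp_all add: add.commute p_def[symmetric] q_def[symmetric]\<close>)
qed

text \<open>The image is an unordered pair, so the side lines are either kept or exchanged, and
  lengths determine the moduli of \<open>p\<close> and \<open>q\<close>. Either way, comparing inner
  products shows \<open>p * q = s\<^sup>2\<close> unless the angle is right, which is expressed by
  Pythagoras.\<close>

lemma corner_ratios:
  fixes V X Y :: "real^2"
  assumes f: "similitude s f" "0 < s" "f V = V" and ne: "X \<noteq> V" "Y \<noteq> V"
    and im: "f ` {X, Y} = {V + p *\<^sub>R (X - V), V + q *\<^sub>R (Y - V)}"
  shows "f X = V + p *\<^sub>R (X - V) \<and> f Y = V + q *\<^sub>R (Y - V) \<and> \<bar>p\<bar> = s \<and> \<bar>q\<bar> = s \<or>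
    f X = V + q *\<^sub>R (Y - V) \<and> f Y = V + p *\<^sub>R (X - V) \<and>
      \<bar>p\<bar> * dist V X = s * dist V Y \<and> \<bar>q\<bar> * dist V Y = s * dist V X"
    and "0 < p * q \<or> (dist X Y)\<^sup>2 = (dist V X)\<^sup>2 + (dist V Y)\<^sup>2"
proof -
  have d: "dist (V + r *\<^sub>R (Z - V)) V = \<bar>r\<bar> * dist V Z" for r Z
    by (simp add: dist_norm norm_minus_commute)
  have fd: "dist (f Z) V = s * dist V Z" for Z
    using similitude_dist[OF f(1,2), of Z V] f(3) by (simp add: dist_commute)
  consider (fixing) "f X = V + p *\<^sub>R (X - V)" "f Y = V + q *\<^sub>R (Y - V)"
    | (swapping) "f X = V + q *\<^sub>R (Y - V)" "f Y = V + p *\<^sub>R (X - V)"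
    using im by (auto simp: doubleton_eq_iff)
  note cs = this
  from cs show "f X = V + p *\<^sub>R (X - V) \<and> f Y = V + q *\<^sub>R (Y - V) \<and> \<bar>p\<bar> = s \<and> \<bar>q\<bar> = s \<or>
    f X = V + q *\<^sub>R (Y - V) \<and> f Y = V + p *\<^sub>R (X - V) \<and>
      \<bar>p\<bar> * dist V X = s * dist V Y \<and> \<bar>q\<bar> * dist V Y = s * dist V X"
  proof cases
    case fixing
    then show ?thesis
      using fd[of X] fd[of Y] d[of p X] d[of q Y] ne by auto
  next
    case swapping
    then show ?thesis
      using fd[of X] fd[of Y] d[of p X] d[of q Y] by auto
  qed
  have "p * q * ((X - V) \<bullet> (Y - V)) = s\<^sup>2 * ((X - V) \<bullet> (Y - V))"
    using cs
  proof cases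
    case fixing
    then show ?thesis
      using similitude_inner[OF f(1), of X V Y] f(3) by (auto simp: mult.commute)
  next
    case swapping
    then show ?thesis
      using similitude_inner[OF f(1), of X V Y] f(3) by (auto simp: inner_commute mult.commute)
  qed
  then have "0 < p * q \<or> (X - V) \<bullet> (Y - V) = 0"
    using f(2) by auto
  moreover have "(dist X Y)\<^sup>2 = (dist V X)\<^sup>2 + (dist V Y)\<^sup>2 - 2 * ((X - V) \<bullet> (Y - V))"
    by (simp add: dist_norm power2_norm_eq_inner algebra_simps inner_commute)
  ultimately show "0 < p * q \<or> (dist X Y)\<^sup>2 = (dist V X)\<^sup>2 + (dist V Y)\<^sup>2"
    by auto
qed

text \<open>A similitude is affine, hence determined by its values at the three corners. For
  positive \<open>p\<close> and \<open>q\<close> these are the values of a homothety or of a scaled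
  reflection in the angle bisector.\<close>

lemma non_flip_map_or_flip_map:
  fixes V X Y :: "real^2"
  assumes f: "similitude s f" "0 < s" "s < 1" "f V = V" and nc: "\<not> collinear {V, X, Y}"
    and im: "f ` {X, Y} = {V + p *\<^sub>R (X - V), V + q *\<^sub>R (Y - V)}" and pq: "0 < p" "0 < q"
  shows "non_flip_map V f \<or> flip_map V X Y f"
proof -
  define u v where "u = X - V" and "v = Y - V"
  have ne: "X \<noteq> V" "Y \<noteq> V"
    using non_collinear_imp_distinct[OF nc] by auto
  have "\<not> collinear {X, V, Y}"
    using nc by (simp add: insert_commute)
  then have uv: "\<not> collinear {0, u, v}"
    unfolding u_def v_def using collinear_3[of X V Y] by auto
  have f_expand: "f (V + \<alpha> *\<^sub>R u + \<beta> *\<^sub>R v) = V + \<alpha> *\<^sub>R (f X - V) + \<beta> *\<^sub>R (f Y - V)" for \<alpha> \<beta>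
    unfolding u_def v_def by (simp add: similitude_expansion[OF f(1)] f(4))
  have expand: "\<exists>\<alpha> \<beta>. x = V + \<alpha> *\<^sub>R u + \<beta> *\<^sub>R v" for x
    using basis_expansion[OF uv, of "x - V"] by (metis add.assoc add_diff_cancel_left' diff_add_cancel add.commute)
  from corner_ratios(1)[OF f(1,2,4) ne im] show ?thesis
  proof
    assume "f X = V + p *\<^sub>R (X - V) \<and> f Y = V + q *\<^sub>R (Y - V) \<and> \<bar>p\<bar> = s \<and> \<bar>q\<bar> = s"
    then have fXY: "f X = V + s *\<^sub>R u" "f Y = V + s *\<^sub>R v"
      using pq by (auto simp: u_def v_def)
    have "f x = V + s *\<^sub>R (x - V)" for x
    proof -
      obtain \<alpha> \<beta> where x: "x = V + \<alpha> *\<^sub>R u + \<beta> *\<^sub>R v"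
        using expand by blast
      show ?thesis
        unfolding x f_expand fXY by (simp add: algebra_simps)
    qed
    then show ?thesis
      using f(2,3) unfolding non_flip_map_def by blast
  next
    assume "f X = V + q *\<^sub>R (Y - V) \<and> f Y = V + p *\<^sub>R (X - V) \<and>
      \<bar>p\<bar> * dist V X = s * dist V Y \<and> \<bar>q\<bar> * dist V Y = s * dist V X"
    then have fXY: "f X = V + q *\<^sub>R v" "f Y = V + p *\<^sub>R u"
      and "p * norm u = s * norm v" "q * norm v = s * norm u"
      using pq by (auto simp: u_def v_def dist_norm norm_minus_commute)
    \<comment> \<open>These ratios turn the exchanged values into multiples of unit vectors, the
      form in which \<open>R\<close> is specified.\<close>
    then have "p = s * norm v / norm u" "q = s * norm u / norm v"
      using ne by (auto simp: u_def v_def field_simps)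
    with fXY have fXY: "f X = V + (s * norm u) *\<^sub>R sgn v" "f Y = V + (s * norm v) *\<^sub>R sgn u"
      by (simp_all add: sgn_div_norm divide_inverse)
    obtain R where R: "linear_reflection R" "R (sgn u) = sgn v" "R (sgn v) = sgn u"
      using swapping_reflection_exists[OF nc] unfolding u_def v_def by blast
    interpret R: linear R
      using linear_reflection_linear[OF R(1)] .
    have Ruv: "R u = norm u *\<^sub>R sgn v" "R v = norm v *\<^sub>R sgn u"
      using R.scale[of "norm u" "sgn u"] R.scale[of "norm v" "sgn v"] ne R(2,3)
      by (auto simp: sgn_div_norm u_def v_def)
    have "f x = V + s *\<^sub>R R (x - V)" for x
    proof -
      obtain \<alpha> \<beta> where x: "x = V + \<alpha> *\<^sub>R u + \<beta> *\<^sub>R v"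
        using expand by blast
      have "R (x - V) = \<alpha> *\<^sub>R R u + \<beta> *\<^sub>R R v"
        by (simp add: x R.add R.scale)
      then show ?thesis
        unfolding Ruv unfolding x f_expand fXY by (simp add: algebra_simps)
    qed
    then show ?thesis
      using f(2,3) R unfolding flip_map_def u_def v_def by blast
  qed
qed

section \<open>Excluding touching points behind a vertex\<close>

context sierpinski_triangle
begin

lemma touching_points_on_lines:
  obtains \<nu> \<mu> \<pi> where
    "N = A + \<nu> *\<^sub>R (B - A)" "M = A + \<mu> *\<^sub>R (C - A)" "P = B + \<pi> *\<^sub>R (C - B)"
  using lines unfolding affine_hull_2_alt by blast

text \<open>The restrictions of \<open>fA\<close> and \<open>fC\<close> to the segment \<open>AC\<close> cover it, hence \<open>AC \<subseteq> K\<close>. The point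
  \<open>A + t\<^sup>2 (C - A)\<close> is then in \<open>fA ` K\<close>, and in the segment \<open>NP\<close>, which is \<open>fB\<close> of \<open>AC\<close>.\<close>

lemma exceptional_configuration_impossible:
  assumes M: "fA C = A + t *\<^sub>R (C - A)" "fC A = A + t *\<^sub>R (C - A)"
    and N: "N = A - t *\<^sub>R (B - A)" "fB C = N" and P: "fB A = B + t *\<^sub>R (C - B)"
    and t: "0 < t" "t < 1"
  shows False
proof -
  define l where "l \<tau> = A + \<tau> *\<^sub>R (C - A)" for \<tau>
  have fA_l: "fA (l \<tau>) = l (\<tau> * t)" for \<tau>
    unfolding l_def similitude_line[OF sim(1)] by (simp add: fixed M)
  have fC_l: "fC (l \<tau>) = l (t + \<tau> * (1 - t))" for \<tau>
    unfolding l_def similitude_line[OF sim(3)] by (simp add: fixed M algebra_simps)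
  have "l ` {0..1} \<subseteq> K"
  proof (rule self_covered_subset[of "{fA, fC}"])
    show "compact (l ` {0..1})"
      unfolding l_def by (intro compact_continuous_image continuous_intros) auto
    show "l ` {0..1} \<subseteq> (\<Union>f\<in>{fA, fC}. f ` l ` {0..1})"
    proof clarify
      fix \<tau> :: real assume \<tau>: "\<tau> \<in> {0..1}"
      show "l \<tau> \<in> (\<Union>f\<in>{fA, fC}. f ` l ` {0..1})"
      proof (cases "\<tau> \<le> t")
        case True
        then have "\<tau> / t \<in> {0..1}" "l \<tau> = fA (l (\<tau> / t))"
          using \<tau> t by (auto simp: fA_l)
        then show ?thesis by blast
      next
        case False
        then have "(\<tau> - t) / (1 - t) \<in> {0..1}" "l \<tau> = fC (l ((\<tau> - t) / (1 - t)))"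
          using \<tau> t by (auto simp: fC_l)
        then show ?thesis by blast
      qed
    qed
  qed (use K compact_imp_closed contractive image_subset in auto)
  then have "l t \<in> K" "l (1 - t) \<in> K"
    using t by auto
  \<comment> \<open>The parameter is chosen so that, on the way from \<open>N\<close> to
    \<open>P\<close>, the component along \<open>B - A\<close> cancels and the point lies on the
    line \<open>AC\<close>.\<close>
  moreover have "fB (l (1 - t)) = fA (l t)"
  proof -
    have "l (1 - t) = C + t *\<^sub>R (A - C)"
      unfolding l_def by (simp add: algebra_simps)
    then show ?thesis
      by (simp add: similitude_line[OF sim(2)] fA_l N P) (simp add: l_def algebra_simps)
  qed
  ultimately have "fA (l t) \<in> fA ` K \<inter> fB ` K"
    by (metis Int_iff imageI)
  then have "fA (l t) = N"
    using touch(1) by auto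
  \<comment> \<open>Equality with \<open>N\<close> would put \<open>B\<close> on the line
    \<open>AC\<close>.\<close>
  then have "t\<^sup>2 *\<^sub>R (C - A) = t *\<^sub>R (A - B)"
    by (simp add: fA_l) (simp add: l_def N power2_eq_square algebra_simps)
  then have "t *\<^sub>R (t *\<^sub>R (C - A)) = t *\<^sub>R (A - B)"
    by (simp add: power2_eq_square flip: scaleR_minus_right)
  then have "A - B = t *\<^sub>R (C - A)"
    using t(1) by (metis scaleR_cancel_left less_irrefl)
  then have "B = A + (- t) *\<^sub>R (C - A)"
    by (simp add: diff_eq_eq) (simp add: algebra_simps)
  then have "B \<in> affine hull {A, C}"
    unfolding affine_hull_2_alt by blast
  then have "collinear {A, C, B}"
    using collinear_3_affine_hull vertices_distinct(2) by blast
  then show False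
    using triangle by (simp add: insert_commute)
qed

lemma touching_point_not_behind:
  assumes "N = A + \<nu> *\<^sub>R (B - A)"
  shows "0 < \<nu>"
proof (rule ccontr)
  assume "\<not> 0 < \<nu>"
  obtain \<mu> \<pi> where M: "M = A + \<mu> *\<^sub>R (C - A)" and P: "P = B + \<pi> *\<^sub>R (C - B)"
    using touching_points_on_lines by metis
  \<comment> \<open>The same points measured from the other end of each side, with complementary
    coefficients.\<close>
  have N': "N = B + (1 - \<nu>) *\<^sub>R (A - B)" and M': "M = C + (1 - \<mu>) *\<^sub>R (A - C)"
    and P': "P = C + (1 - \<pi>) *\<^sub>R (B - C)"
    by (simp_all add: assms M P algebra_simps)
  have "\<nu> \<noteq> 0"
  proof
    assume "\<nu> = 0"
    then have "A \<in> fB ` K"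
      using touch(1) assms by auto
    then show False
      using vertices_notin by blast
  qed
  with \<open>\<not> 0 < \<nu>\<close> have neg: "\<nu> < 0" by simp
  define a b c where "a = dist B C" and "b = dist A C" and "c = dist A B"
  have dists: "dist B C = a" "dist C B = a" "dist A C = b" "dist C A = b" "dist A B = c" "dist B A = c"
    by (simp_all add: a_def b_def c_def dist_commute)
  have abc: "0 < a" "0 < b" "0 < c"
    using vertices_distinct by (auto simp: a_def b_def c_def)
  note cA = corner_ratios[OF sim(1) pos(1) fixed(1), of B C \<nu> \<mu>, unfolded dists, folded assms M]
  note cB = corner_ratios[OF sim(2) pos(2) fixed(2), of A C "1 - \<nu>" \<pi>, unfolded dists, folded N' P]
  note cC = corner_ratios[OF sim(3) pos(3) fixed(3), of A B "1 - \<mu>" "1 - \<pi>", unfolded dists, folded M' P']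
  note vertices_distinct[symmetric]
  note cA = cA[OF this(1,2) corners(1)]
  have cB: "fB A = N \<and> fB C = P \<and> \<bar>1 - \<nu>\<bar> = sB \<and> \<bar>\<pi>\<bar> = sB \<or>
      fB A = P \<and> fB C = N \<and> \<bar>1 - \<nu>\<bar> * c = sB * a \<and> \<bar>\<pi>\<bar> * a = sB * c"
    "0 < (1 - \<nu>) * \<pi> \<or> b\<^sup>2 = a\<^sup>2 + c\<^sup>2"
    using cB vertices_distinct corners(2) by auto
  have cC: "fC A = M \<and> fC B = P \<and> \<bar>1 - \<mu>\<bar> = sC \<and> \<bar>1 - \<pi>\<bar> = sC \<or>
      fC A = P \<and> fC B = M \<and> \<bar>1 - \<mu>\<bar> * b = sC * a \<and> \<bar>1 - \<pi>\<bar> * a = sC * b"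
    "0 < (1 - \<mu>) * (1 - \<pi>) \<or> c\<^sup>2 = a\<^sup>2 + b\<^sup>2"
    using cC vertices_distinct corners(3) by auto
  have sol: "\<bar>1 - \<nu>\<bar> \<noteq> sB" "\<mu> = sA" "\<nu> = - sA" "\<pi> = sA" "sC = 1 - sA" "b \<noteq> c" "a \<noteq> b"
    by (rule signed_ratios_solution[OF abc pos less1 sum_squares_le_1 _ _ _ _ cB(2) cC(2) neg];
        use cA cB(1) cC(1) in argo)+
  \<comment> \<open>Here \<open>b \<noteq> c\<close> rules out an exchange at \<open>A\<close>, and
    below \<open>a \<noteq> b\<close> rules one out at \<open>C\<close>.\<close>
  have "fA C = M"
    using cA(1) sol pos by auto
  moreover have "fB A = P" "fB C = N"
    using cB(1) sol(1) by auto
  moreover have "fC A = M"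
    using cC(1) sol pos by auto
  ultimately show False
    using exceptional_configuration_impossible[of sA] M P assms sol pos(1) less1(1) by simp
qed

end

lemma (in sierpinski_triangle) touching_points_ahead:
  assumes "N = A + \<nu> *\<^sub>R (B - A)" "M = A + \<mu> *\<^sub>R (C - A)"
  shows "0 < \<nu>" "0 < \<mu>"
proof -
  interpret ACB: sierpinski_triangle K fA fC fB A C B sA sC sB M N P
    by (rule sierpinski_triangle_swap_BC) unfold_locales
  show "0 < \<nu>" "0 < \<mu>"
    using touching_point_not_behind ACB.touching_point_not_behind assms by blast+
qed

lemma (in sierpinski_triangle) non_flip_or_flip_at_A:
  "non_flip_map A fA \<or> flip_map A B C fA"
proof -
  obtain \<nu> \<mu> where N: "N = A + \<nu> *\<^sub>R (B - A)" and M: "M = A + \<mu> *\<^sub>R (C - A)"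
    using touching_points_on_lines by metis
  show ?thesis
    by (rule non_flip_map_or_flip_map[OF sim(1) pos(1) less1(1) fixed(1) triangle _
          touching_points_ahead[OF N M]]) (use corners(1) N M in simp)
qed

lemma generalised_sierpinski_triangle_map_types:
  assumes "generalised_sierpinski_triangle K fA fB fC A B C"
  shows "non_flip_map A fA \<or> flip_map A B C fA" "non_flip_map B fB \<or> flip_map B A C fB"
    "non_flip_map C fC \<or> flip_map C A B fC"
proof -
  obtain sA sB sC N M P where "sierpinski_triangle K fA fB fC A B C sA sB sC N M P"
    using assms generalised_sierpinski_triangle_iff by blast
  then interpret sierpinski_triangle K fA fB fC A B C sA sB sC N M P .
  interpret BAC: sierpinski_triangle K fB fA fC B A C sB sA sC N P M
    by (rule sierpinski_triangle_swap_AB) unfold_locales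
  interpret ACB: sierpinski_triangle K fA fC fB A C B sA sC sB M N P
    by (rule sierpinski_triangle_swap_BC) unfold_locales
  interpret CAB: sierpinski_triangle K fC fA fB C A B sC sA sB M P N
    by (rule sierpinski_triangle_swap_AB) unfold_locales
  show "non_flip_map A fA \<or> flip_map A B C fA" "non_flip_map B fB \<or> flip_map B A C fB"
    "non_flip_map C fC \<or> flip_map C A B fC"
    by (fact non_flip_or_flip_at_A BAC.non_flip_or_flip_at_A CAB.non_flip_or_flip_at_A)+
qed

subsection \<open>Existence of all types\<close>

lemma non_collinear_coordinates_unique:
  fixes u v :: "'a::real_vector"
  assumes nc: "\<not> collinear {0, u, v}"
    and eq: "\<alpha> *\<^sub>R u + \<beta> *\<^sub>R v = \<alpha>' *\<^sub>R u + \<beta>' *\<^sub>R v"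
  shows "\<alpha> = \<alpha>'" "\<beta> = \<beta>'"
proof -
  have *: "(\<beta> - \<beta>') *\<^sub>R v = (\<alpha>' - \<alpha>) *\<^sub>R u"
    using eq by (simp add: algebra_simps)
  show "\<beta> = \<beta>'"
  proof (rule ccontr)
    assume "\<beta> \<noteq> \<beta>'"
    then have "v = ((\<alpha>' - \<alpha>) / (\<beta> - \<beta>')) *\<^sub>R u"
      using arg_cong[OF *, of "\<lambda>x. (1 / (\<beta> - \<beta>')) *\<^sub>R x"] by simp
    then show False
      using nc unfolding collinear_lemma by blast
  qed
  then show "\<alpha> = \<alpha>'"
    using * nc by (auto simp: collinear_lemma)
qed

text \<open>Iterating the union of images from the invariant compact set \<open>T\<close> gives
  decreasing compact sets, whose intersection is an attractor.\<close>

lemma attractor_exists: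
  fixes T :: "(real^2) set"
  assumes F: "finite F" "F \<noteq> {}" "\<And>f. f \<in> F \<Longrightarrow> continuous_on T f" "\<And>f. f \<in> F \<Longrightarrow> f ` T \<subseteq> T"
    and T: "compact T" "T \<noteq> {}"
  obtains K where "is_attractor F K" "K \<subseteq> T"
proof -
  define H where "H X = (\<Union>f\<in>F. f ` X)" for X
  define D where "D n = (H ^^ n) T" for n
  have D_Suc: "D (Suc n) = (\<Union>f\<in>F. f ` D n)" for n
    by (simp add: D_def H_def)
  have D_0: "D 0 = T"
    by (simp add: D_def)
  have D_dec: "D (Suc n) \<subseteq> D n" for n
  proof (induction n)
    case 0
    then show ?case
      using F(4) by (auto simp: D_Suc D_0)
  next
    case (Suc n)
    then show ?case
      by (subst (1 2) D_Suc) blast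
  qed
  then have D_anti: "D n \<subseteq> D m" if "m \<le> n" for m n
    using that by (rule lift_Suc_antimono_le)
  have DT: "D n \<subseteq> T" for n
    using D_anti[of 0 n] by (simp add: D_0)
  have D: "compact (D n)" "D n \<noteq> {}" for n
  proof -
    have "compact (D n) \<and> D n \<noteq> {}"
    proof (induction n)
      case (Suc n)
      have "compact (f ` D n)" if "f \<in> F" for f
        using compact_continuous_image[OF continuous_on_subset[OF F(3)[OF that] DT]] Suc by blast
      then show ?case
        unfolding D_Suc using Suc F(1,2) by (auto intro!: compact_UN)
    qed (simp add: D_0 T)
    then show "compact (D n)" "D n \<noteq> {}" by auto
  qed
  define K where "K = (\<Inter>n. D n)"
  have KT: "K \<subseteq> T"
    unfolding K_def using DT by blast
  have "K \<noteq> {}"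
    unfolding K_def by (rule compact_nest) (use D D_anti in auto)
  moreover have "compact K"
    unfolding K_def using D(1) by (intro compact_Inter) auto
  moreover have "K = (\<Union>f\<in>F. f ` K)"
  proof
    show "(\<Union>f\<in>F. f ` K) \<subseteq> K"
    proof clarify
      fix f x assume "f \<in> F" "x \<in> K"
      then have "f x \<in> D (Suc n)" for n
        unfolding D_Suc K_def by blast
      then show "f x \<in> K"
        unfolding K_def using D_dec by blast
    qed
    show "K \<subseteq> (\<Union>f\<in>F. f ` K)"
    proof
      fix x assume x: "x \<in> K"
      \<comment> \<open>If each map missed \<open>x\<close> at some level, finiteness of
        \<open>F\<close> and monotonicity would give a level at which all maps miss it.\<close>
      have "\<exists>f\<in>F. \<forall>n. x \<in> f ` D n"
      proof (rule ccontr)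
        assume "\<not> ?thesis"
        then obtain k where k: "\<And>f. f \<in> F \<Longrightarrow> x \<notin> f ` D (k f)"
          by metis
        have "x \<notin> f ` D (Max (k ` F))" if "f \<in> F" for f
          using k[OF that] D_anti[of "k f" "Max (k ` F)"] F(1) that by fastforce
        then have "x \<notin> D (Suc (Max (k ` F)))"
          unfolding D_Suc by blast
        then show False
          using x unfolding K_def by blast
      qed
      then obtain f where f: "f \<in> F" "\<And>n. x \<in> f ` D n"
        by blast
      \<comment> \<open>The fibres of \<open>f\<close> over \<open>x\<close> are nested nonempty
        compact sets; a common point is a preimage of \<open>x\<close> in \<open>K\<close>.\<close>
      have "\<Inter> (range (\<lambda>n. {y \<in> D n. f y \<in> {x}})) \<noteq> {}"
      proof (rule compact_nest)
        fix n
        have "continuous_on (D n) f"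
          using F(3)[OF f(1)] DT continuous_on_subset by blast
        then have "closed {y \<in> D n. f y \<in> {x}}"
          using continuous_closed_preimage[of "D n" f "{x}"] compact_imp_closed[OF D(1)]
          by (simp add: vimage_def Int_def conj_commute)
        then show "compact {y \<in> D n. f y \<in> {x}}"
          using compact_Int_closed[OF D(1)[of n], of "{y \<in> D n. f y \<in> {x}}"]
          by (simp add: Int_def)
        show "{y \<in> D n. f y \<in> {x}} \<noteq> {}"
          using f(2)[of n] by auto
      qed (use D_anti in blast)
      then have "x \<in> f ` K"
        unfolding K_def by blast
      then show "x \<in> (\<Union>f\<in>F. f ` K)"
        using f(1) by blast
    qed
  qed
  ultimately show ?thesis
    using that KT unfolding is_attractor_def by blast
qed

section \<open>Gaskets of ratio one half\<close>

lemma similitude_convex_hull_3: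
  assumes "similitude s f"
  shows "f ` (convex hull {V, X, Y}) = convex hull {f V, f X, f Y}"
proof -
  have "f ` (convex hull {V, X, Y}) =
      {f (V + u *\<^sub>R (X - V) + v *\<^sub>R (Y - V)) | u v. 0 \<le> u \<and> 0 \<le> v \<and> u + v \<le> 1}"
    unfolding convex_hull_3_alt by blast
  then show ?thesis
    unfolding similitude_expansion[OF assms] convex_hull_3_alt .
qed

lemma midpoint_alt: "midpoint x y = x + (1/2) *\<^sub>R (y - x)"
proof -
  have "(1/2) *\<^sub>R (y - x) + (1/2) *\<^sub>R (y - x) = y - x"
    by (simp flip: scaleR_add_left)
  then have "x + (1/2) *\<^sub>R (y - x) + (x + (1/2) *\<^sub>R (y - x)) = x + y"
    by (metis (no_types) add.assoc add.commute diff_add_cancel)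
  then show ?thesis
    by (metis midpoint_eq_iff)
qed

text \<open>In the basis \<open>X - V\<close>, \<open>Y - V\<close> centred at \<open>V\<close>, the
  first coordinate is at most 1/2 on the triangle at \<open>V\<close> and at least 1/2 on the one at
  \<open>X\<close>; equality leaves only the midpoint.\<close>

lemma corner_triangles_touch:
  fixes V X Y :: "'a::real_vector"
  assumes "\<not> collinear {0, X - V, Y - V}"
  shows "convex hull {V, midpoint V X, midpoint V Y} \<inter> convex hull {X, midpoint X V, midpoint X Y}
    \<subseteq> {midpoint V X}"
proof clarify
  define u v where "u = X - V" and "v = Y - V"
  have XY: "X = V + u" "Y = V + v"
    by (simp_all add: u_def v_def)
  fix z assume z: "z \<in> convex hull {V, midpoint V X, midpoint V Y}"
    "z \<in> convex hull {X, midpoint X V, midpoint X Y}"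
  obtain a b where ab: "0 \<le> a" "0 \<le> b" "a + b \<le> 1"
    "z = V + a *\<^sub>R (midpoint V X - V) + b *\<^sub>R (midpoint V Y - V)"
    using z(1) unfolding convex_hull_3_alt by blast
  obtain c d where cd: "0 \<le> c" "0 \<le> d" "c + d \<le> 1"
    "z = X + c *\<^sub>R (midpoint X V - X) + d *\<^sub>R (midpoint X Y - X)"
    using z(2) unfolding convex_hull_3_alt by blast
  have z1: "z = V + ((a / 2) *\<^sub>R u + (b / 2) *\<^sub>R v)"
    unfolding ab(4) XY midpoint_alt by simp
  have z2: "z = V + ((1 - c / 2 - d / 2) *\<^sub>R u + (d / 2) *\<^sub>R v)"
    unfolding cd(4) XY midpoint_alt by simp (simp add: algebra_simps flip: scaleR_add_left)
  have "(a / 2) *\<^sub>R u + (b / 2) *\<^sub>R v = (1 - c / 2 - d / 2) *\<^sub>R u + (d / 2) *\<^sub>R v"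
    using z1 z2 by simp
  note non_collinear_coordinates_unique[OF assms[folded u_def v_def] this]
  then have "a = 1" "b = 0"
    using ab cd by auto
  then show "z = midpoint V X"
    unfolding ab(4) by simp
qed

lemma linear_reflection_orthogonal:
  assumes "linear_reflection R"
  shows "orthogonal_transformation R"
proof -
  obtain u where u: "norm u = 1" "\<And>x. R x = (2 * (x \<bullet> u)) *\<^sub>R u - x"
    using assms unfolding linear_reflection_def by blast
  have uu: "u \<bullet> u = 1"
    using u(1) by (simp add: dot_square_norm)
  have "R x \<bullet> R y = x \<bullet> y" for x y
    unfolding u(2) by (simp add: inner_diff_left inner_diff_right uu inner_commute[of u x] inner_commute[of u y])
  then show ?thesis
    using linear_reflection_linear[OF assms] by (simp add: orthogonal_transformation_def)
qed

lemma similitude_orthogonal_transformation: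
  assumes "orthogonal_transformation R"
  shows "similitude s (\<lambda>x. V + s *\<^sub>R R (x - V))"
proof -
  have R: "linear R" "orthogonal_matrix (matrix R)"
    using assms orthogonal_transformation_matrix by (auto simp: orthogonal_transformation_linear)
  have "V + s *\<^sub>R R (x - V) = s *\<^sub>R (matrix R *v x) + (V - s *\<^sub>R R V)" for x
    using R(1) by (simp add: matrix_works linear_diff algebra_simps)
  then show ?thesis
    using R(2) unfolding similitude_def by blast
qed

text \<open>Equal side lengths make the reflection exchange \<open>X - V\<close> and
  \<open>Y - V\<close> exactly, so both types have the same corner set.\<close>

lemma half_scale_map_exists:
  fixes V X Y :: "real^2"
  assumes nc: "\<not> collinear {V, X, Y}" and iso: "dist V X = dist V Y"
  obtains f where "similitude (1/2) f" "f V = V" "f ` {X, Y} = {midpoint V X, midpoint V Y}"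
    "has_map_type \<tau> V X Y f"
proof -
  have half: "V + (1/2) *\<^sub>R (Z - V) = midpoint V Z" for Z
    by (simp add: midpoint_alt)
  have ne: "X \<noteq> V" "Y \<noteq> V"
    using non_collinear_imp_distinct[OF nc] by auto
  have XY: "norm (X - V) *\<^sub>R sgn (Y - V) = Y - V" "norm (Y - V) *\<^sub>R sgn (X - V) = X - V"
    using iso ne by (auto simp: sgn_div_norm dist_norm norm_minus_commute)
  show ?thesis
  proof (cases \<tau>)
    case NonFlip
    have "similitude (1/2) (\<lambda>x. V + (1/2) *\<^sub>R (x - V))"
      using similitude_orthogonal_transformation[OF orthogonal_transformation_id] by simp
    then show ?thesis
      by (rule that) (auto simp: NonFlip non_flip_map_def half intro!: exI[of _ "1/2"])
  next
    case Flip
    obtain R where R: "linear_reflection R" "R (sgn (X - V)) = sgn (Y - V)"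
      "R (sgn (Y - V)) = sgn (X - V)"
      using swapping_reflection_exists[OF nc] by blast
    interpret R: linear R
      using linear_reflection_linear[OF R(1)] .
    have RX: "R (X - V) = Y - V" "R (Y - V) = X - V"
      using R.scale[of "norm (X - V)" "sgn (X - V)"] R.scale[of "norm (Y - V)" "sgn (Y - V)"]
        R(2,3) XY ne by (auto simp: sgn_div_norm)
    show ?thesis
    proof (rule that)
      show "similitude (1/2) (\<lambda>x. V + (1/2) *\<^sub>R R (x - V))"
        by (rule similitude_orthogonal_transformation[OF linear_reflection_orthogonal[OF R(1)]])
      show "has_map_type \<tau> V X Y (\<lambda>x. V + (1/2) *\<^sub>R R (x - V))"
        using R unfolding Flip by (auto simp: flip_map_def intro!: exI[of _ "1/2"] exI[of _ R])
    qed (auto simp: RX R.zero half)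
  qed
qed

text \<open>Only the corner sets enter, so flips and non-flips are treated alike: the large triangle
  is sent to its three corner triangles, which meet only at midpoints of sides.\<close>

lemma half_scale_sierpinski_triangle:
  assumes sim: "similitude (1/2) fA" "similitude (1/2) fB" "similitude (1/2) fC"
    and fixed: "fA A = A" "fB B = B" "fC C = C" and nc: "\<not> collinear {A, B, C}"
    and corners: "fA ` {B, C} = {midpoint A B, midpoint A C}"
      "fB ` {A, C} = {midpoint B A, midpoint B C}"
      "fC ` {A, B} = {midpoint C A, midpoint C B}"
  shows "\<exists>K. generalised_sierpinski_triangle K fA fB fC A B C"
proof -
  define T where "T = convex hull {A, B, C}"
  have mid: "midpoint x y \<in> T" if "x \<in> {A, B, C}" "y \<in> {A, B, C}" for x y
    using that unfolding T_def
    by (meson hull_inc convex_convex_hull convex_contains_segment midpoint_in_closed_segment subsetD)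
  have fAT: "fA ` T = convex hull {A, midpoint A B, midpoint A C}"
  proof -
    have "fA ` T = convex hull (insert A (fA ` {B, C}))"
      unfolding T_def similitude_convex_hull_3[OF sim(1)] by (simp add: fixed)
    then show ?thesis
      by (simp only: corners)
  qed
  have fBT: "fB ` T = convex hull {B, midpoint B A, midpoint B C}"
  proof -
    have "fB ` T = convex hull (insert B (fB ` {A, C}))"
      unfolding T_def similitude_convex_hull_3[OF sim(2)] by (simp add: fixed insert_commute)
    then show ?thesis
      by (simp only: corners)
  qed
  have fCT: "fC ` T = convex hull {C, midpoint C A, midpoint C B}"
  proof -
    have "fC ` T = convex hull (insert C (fC ` {A, B}))"
      unfolding T_def similitude_convex_hull_3[OF sim(3)] by (simp add: fixed insert_commute)
    then show ?thesis
      by (simp only: corners)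
  qed
  have sub: "f ` T \<subseteq> T" if "f \<in> {fA, fB, fC}" for f
  proof -
    have "convex hull {x, midpoint x y, midpoint x z} \<subseteq> T"
      if "x \<in> {A, B, C}" "y \<in> {A, B, C}" "z \<in> {A, B, C}" for x y z
      using that mid[of x y] mid[of x z] mid[of x x]
      by (intro hull_minimal) (auto simp: T_def)
    then have "fA ` T \<subseteq> T" "fB ` T \<subseteq> T" "fC ` T \<subseteq> T"
      unfolding fAT fBT fCT by simp_all
    then show ?thesis
      using that by auto
  qed
  have cs: "contractive_similitude f" if "f \<in> {fA, fB, fC}" for f
    using that sim unfolding contractive_similitude_iff by (intro exI[of _ "1/2"]) auto
  have "compact T"
    unfolding T_def by (simp add: finite_imp_compact_convex_hull)
  obtain K where K: "is_attractor {fA, fB, fC} K" "K \<subseteq> T"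
  proof (rule attractor_exists)
    show "continuous_on T f" if "f \<in> {fA, fB, fC}" for f
      using that sim similitude_continuous[of "1/2"] by auto
  qed (use sub \<open>compact T\<close> in \<open>auto simp: T_def\<close>)
  have K': "K \<noteq> {}" "compact K" "K = fA ` K \<union> fB ` K \<union> fC ` K"
    using K(1) unfolding is_attractor_def by auto
  \<comment> \<open>Vertices lie in \<open>K\<close> as fixed points, so the midpoints really are
    common to the pieces.\<close>
  have "{A, B, C} \<subseteq> K"
  proof (rule self_covered_subset[OF cs K'(1) compact_imp_closed[OF K'(2)]])
    show "f ` K \<subseteq> K" if "f \<in> {fA, fB, fC}" for f
      using that K'(3) by blast
  qed (use fixed in auto)
  then have "fA ` {B, C} \<subseteq> fA ` K" "fB ` {A, C} \<subseteq> fB ` K" "fC ` {A, B} \<subseteq> fC ` K"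
    by blast+
  then have mids: "{midpoint A B, midpoint A C} \<subseteq> fA ` K" "{midpoint A B, midpoint B C} \<subseteq> fB ` K"
    "{midpoint A C, midpoint B C} \<subseteq> fC ` K"
    unfolding corners midpoint_sym[of B A] midpoint_sym[of C A] midpoint_sym[of C B] .
  have nc': "\<not> collinear {0, B - A, C - A}" "\<not> collinear {0, C - A, B - A}"
    "\<not> collinear {0, C - B, A - B}"
    using nc collinear_3[of B A C] collinear_3[of C A B] collinear_3[of C B A]
    by (auto simp: insert_commute)
  note image_mono[OF K(2)]
  note sub_hull = this[of fA, unfolded fAT] this[of fB, unfolded fBT] this[of fC, unfolded fCT]
  have singleton: "S \<inter> S' = {z}"
    if "H \<inter> H' \<subseteq> {z}" "S \<subseteq> H" "S' \<subseteq> H'" "z \<in> S" "z \<in> S'" for S S' H H' and z :: "real^2"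
    using that by blast
  have touch: "fA ` K \<inter> fB ` K = {midpoint A B}"
    by (rule singleton[OF corner_triangles_touch[OF nc'(1)] sub_hull(1,2)]) (use mids in simp_all)
  have touch': "fA ` K \<inter> fC ` K = {midpoint A C}"
    by (rule singleton[OF corner_triangles_touch[OF nc'(2)]])
      (use mids sub_hull in \<open>simp_all add: insert_commute\<close>)
  have touch'': "fB ` K \<inter> fC ` K = {midpoint B C}"
    by (rule singleton[OF corner_triangles_touch[OF nc'(3)]])
      (use mids sub_hull in \<open>simp_all add: insert_commute\<close>)
  have lines: "midpoint x y \<in> affine hull {x, y}" for x y :: "real^2"
    unfolding affine_hull_2_alt midpoint_alt by blast
  have corners': "fB ` {A, C} = {midpoint A B, midpoint B C}" "fC ` {A, B} = {midpoint A C, midpoint B C}"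
    using corners by (simp_all only: midpoint_sym[of B A] midpoint_sym[of C A] midpoint_sym[of C B])
  have "sierpinski_triangle K fA fB fC A B C (1/2) (1/2) (1/2)
      (midpoint A B) (midpoint A C) (midpoint B C)"
    by (rule sierpinski_triangle.intro)
      (fact sim K(1) fixed nc touch touch' touch'' corners(1) corners' lines | simp)+
  then show ?thesis
    using generalised_sierpinski_triangle_iff by blast
qed

lemma equilateral_triangle_exists:
  obtains A B C :: "real^2" where "\<not> collinear {A, B, C}" "dist A B = dist A C"
    "dist B A = dist B C" "dist C A = dist C B"
proof
  let ?A = "vector [-1, 0] :: real^2" and ?B = "vector [1, 0] :: real^2"
    and ?C = "vector [0, sqrt 3] :: real^2"
  show "\<not> collinear {?A, ?B, ?C}"
    unfolding collinear_3_expand by (auto simp: vec_eq_iff forall_2)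
  show "dist ?A ?B = dist ?A ?C" "dist ?B ?A = dist ?B ?C" "dist ?C ?A = dist ?C ?B"
    by (simp_all add: dist_vec_def L2_set_def sum_2 dist_real_def)
qed

text \<open>An equilateral triangle is isosceles at every vertex, so the three map types can be
  prescribed independently.\<close>

lemma sierpinski_triangle_of_type_exists:
  "\<exists>K fA fB fC A B C. generalised_sierpinski_triangle K fA fB fC A B C \<and>
     has_triangle_type {#a, b, c#} fA fB fC A B C"
proof -
  obtain A B C :: "real^2" where ABC: "\<not> collinear {A, B, C}" "dist A B = dist A C"
    "dist B A = dist B C" "dist C A = dist C B"
    by (rule equilateral_triangle_exists)
  have nc: "\<not> collinear {B, A, C}" "\<not> collinear {C, A, B}"
    using ABC(1) by (simp_all add: insert_commute)
  obtain fA where fA: "similitude (1/2) fA" "fA A = A" "fA ` {B, C} = {midpoint A B, midpoint A C}"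
    "has_map_type a A B C fA"
    using half_scale_map_exists[OF ABC(1,2)] by metis
  obtain fB where fB: "similitude (1/2) fB" "fB B = B" "fB ` {A, C} = {midpoint B A, midpoint B C}"
    "has_map_type b B A C fB"
    using half_scale_map_exists[OF nc(1) ABC(3)] by metis
  obtain fC where fC: "similitude (1/2) fC" "fC C = C" "fC ` {A, B} = {midpoint C A, midpoint C B}"
    "has_map_type c C A B fC"
    using half_scale_map_exists[OF nc(2) ABC(4)] by metis
  have "has_triangle_type {#a, b, c#} fA fB fC A B C"
    unfolding has_triangle_type_def using fA(4) fB(4) fC(4) by blast
  then show ?thesis
    using half_scale_sierpinski_triangle[OF fA(1) fB(1) fC(1) fA(2) fB(2) fC(2) ABC(1) fA(3) fB(3) fC(3)]
    by blast
qed

section \<open>Uniqueness of the type\<close>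

lemma flip_map_not_non_flip_map:
  assumes nc: "\<not> collinear {V, X, Y}" and f: "flip_map V X Y f"
  shows "\<not> non_flip_map V f"
proof
  assume "non_flip_map V f"
  then obtain s where s: "0 < s" "\<And>x. f x = V + s *\<^sub>R (x - V)"
    unfolding non_flip_map_def by blast
  obtain r R where r: "0 < r" and R: "linear_reflection R" "R (sgn (X - V)) = sgn (Y - V)"
    and fR: "\<And>x. f x = V + r *\<^sub>R R (x - V)"
    using f unfolding flip_map_def by blast
  have ne: "X \<noteq> V" "Y \<noteq> V"
    using non_collinear_imp_distinct[OF nc] by auto
  \<comment> \<open>Evaluated at the unit vector towards \<open>X\<close>, the two descriptions
    force both sides at \<open>V\<close> to have the same direction.\<close>
  have "s *\<^sub>R sgn (X - V) = r *\<^sub>R sgn (Y - V)"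
    using s(2)[of "V + sgn (X - V)"] fR[of "V + sgn (X - V)"] R(2) by simp
  moreover from this have "norm (s *\<^sub>R sgn (X - V)) = norm (r *\<^sub>R sgn (Y - V))"
    by simp
  then have "s = r"
    using s(1) r ne by (simp add: norm_sgn)
  ultimately have eq: "sgn (X - V) = sgn (Y - V)"
    using r by simp
  have "Y - V = norm (Y - V) *\<^sub>R sgn (X - V)"
    using ne by (simp add: eq) (simp add: sgn_div_norm)
  also have "\<dots> = (norm (Y - V) / norm (X - V)) *\<^sub>R (X - V)"
    by (simp add: sgn_div_norm divide_inverse)
  finally have "collinear {0, X - V, Y - V}"
    unfolding collinear_lemma by blast
  then have "collinear {X, V, Y}"
    by (subst collinear_3) auto
  then show False
    using nc by (simp add: insert_commute)
qed

lemma has_map_type_unique: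
  assumes "\<not> collinear {V, X, Y}" "has_map_type \<sigma> V X Y f" "has_map_type \<tau> V X Y f"
  shows "\<sigma> = \<tau>"
  using assms flip_map_not_non_flip_map[OF assms(1)] by (cases \<sigma>; cases \<tau>) auto

lemma triangle_types:
  "{#a, b, c#} \<in> {triangle_NNN, triangle_FNN, triangle_FFN, triangle_FFF}"
  unfolding triangle_NNN_def triangle_FNN_def triangle_FFN_def triangle_FFF_def
  by (cases a; cases b; cases c) (simp_all add: add_mset_commute)

lemma generalised_sierpinski_triangle_unique_type:
  assumes "generalised_sierpinski_triangle K fA fB fC A B C"
  shows "\<exists>!T. has_triangle_type T fA fB fC A B C"
proof -
  have nc: "\<not> collinear {A, B, C}" "\<not> collinear {B, A, C}" "\<not> collinear {C, A, B}"
    using assms unfolding generalised_sierpinski_triangle_def by (auto simp: insert_commute)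
  obtain a b c where abc: "has_map_type a A B C fA" "has_map_type b B A C fB"
    "has_map_type c C A B fC"
    using generalised_sierpinski_triangle_map_types[OF assms] by (metis has_map_type.simps)
  show ?thesis
  proof (rule ex1I)
    show "has_triangle_type {#a, b, c#} fA fB fC A B C"
      unfolding has_triangle_type_def using abc by blast
    show "T = {#a, b, c#}" if "has_triangle_type T fA fB fC A B C" for T
      using that abc nc[THEN has_map_type_unique] unfolding has_triangle_type_def by blast
  qed
qed

theorem mainTheorem1:
  shows "(\<forall>K fA fB fC A B C. generalised_sierpinski_triangle K fA fB fC A B C \<longrightarrow>
            (non_flip_map A fA \<or> flip_map A B C fA) \<and>
            (non_flip_map B fB \<or> flip_map B A C fB) \<and>
            (non_flip_map C fC \<or> flip_map C A B fC) \<and>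
            (\<exists>!T. T \<in> {triangle_NNN, triangle_FNN, triangle_FFN, triangle_FFF} \<and>
                  has_triangle_type T fA fB fC A B C)) \<and>
         (\<forall>T \<in> {triangle_NNN, triangle_FNN, triangle_FFN, triangle_FFF}.
            \<exists>K fA fB fC A B C. generalised_sierpinski_triangle K fA fB fC A B C \<and>
                               has_triangle_type T fA fB fC A B C)"
proof (intro conjI allI impI ballI)
  fix K fA fB fC and A B C :: "real^2"
  assume gst: "generalised_sierpinski_triangle K fA fB fC A B C"
  show "non_flip_map A fA \<or> flip_map A B C fA" "non_flip_map B fB \<or> flip_map B A C fB"
    "non_flip_map C fC \<or> flip_map C A B fC"
    using generalised_sierpinski_triangle_map_types[OF gst] .
  have "T \<in> {triangle_NNN, triangle_FNN, triangle_FFN, triangle_FFF}"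
    if "has_triangle_type T fA fB fC A B C" for T
    using that triangle_types unfolding has_triangle_type_def by blast
  then show "\<exists>!T. T \<in> {triangle_NNN, triangle_FNN, triangle_FFN, triangle_FFF} \<and>
      has_triangle_type T fA fB fC A B C"
    using generalised_sierpinski_triangle_unique_type[OF gst] by blast
next
  fix T assume "T \<in> {triangle_NNN, triangle_FNN, triangle_FFN, triangle_FFF}"
  then have "\<exists>a b c. T = {#a, b, c#}"
    unfolding triangle_NNN_def triangle_FNN_def triangle_FFN_def triangle_FFF_def by blast
  then show "\<exists>K fA fB fC A B C. generalised_sierpinski_triangle K fA fB fC A B C \<and>
      has_triangle_type T fA fB fC A B C"
    using sierpinski_triangle_of_type_exists by blast
qed

end
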